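(* Let $Y$ be a smooth complex variety, let $B_1,B_2$ be reduced divisors on $Y$, and let $G$ be a finite group. For each $i=1,2$, let $\phi_i:X_i\to Y$ be the $G$-cover induced by a surjection $\theta_i:\pi_1(Y\setminus B_i)\twoheadrightarrow G$. Let $C_1$ be an algebraic subset of $Y$ such that no irreducible component of $C_1$ is contained in $B_1$, and $C_1\setminus B_1$ is connected. Assume that there exist a homeomorphism $h:Y\to Y$ with $h(B_1)=B_2$ and an automorphism $\sigma:G\to G$ such that $\sigma\circ\theta_2\circ h_{\ast}=\theta_1$, where $h_\ast:\pi_1(Y\setminus B_1)\to\pi_1(Y\setminus B_2)$ is the isomorphism induced by $h$. Put $C_2:=h(C_1)$. Then $c_{\phi_1}(C_1)=c_{\phi_2}(C_2)$.
   Context: Varieties are over $\mathbb{C}$, and topological notions refer to the classical topology. The $G$-cover $\phi:X\to Y$ induced by a surjection $\theta:\pi_1(Y\setminus B)\twoheadrightarrow G$ is the finite Galois cover with $X$ normal which is unramified over $Y\setminus B$ and whose restriction over $Y\setminus B$ is the connected covering corresponding to $\ker\theta$. For a Galois cover $\phi:X\to Y$ branched along $B$ and a subset $C\subset Y$ (an algebraic subset none of whose irreducible components is contained in $B$ and with $C\setminus B$ connected; or, as for $C_2$, the image of such a set under the given homeomorphism), the connected number $c_\phi(C)$ is the number of connected components of $\phi^{-1}(C\setminus B)$. *)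

theory Defs
  imports "HOL-Analysis.Analysis" "HOL-Algebra.Coset"
begin

section \<open>Complex varieties as spaces with functions\<close>

text \<open>
  A complex variety is represented, in the style of Serre, by its set of closed points with the
  Zariski topology and the sheaf of regular functions. \<open>regular X U f\<close> is meaningful for Zariski
  open \<open>U\<close> only, and depends only on the restriction of \<open>f\<close> to \<open>U\<close>.
\<close>

record 'a space_with_functions =
  zariski :: "'a topology"
  regular :: "'a set \<Rightarrow> ('a \<Rightarrow> complex) \<Rightarrow> bool"

abbreviation points :: "('a, 'm) space_with_functions_scheme \<Rightarrow> 'a set"
  where "points X \<equiv> topspace (zariski X)"

abbreviation zopen :: "('a, 'm) space_with_functions_scheme \<Rightarrow> 'a set \<Rightarrow> bool"
  where "zopen X U \<equiv> openin (zariski X) U"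

definition sheaf_of_functions :: "'a space_with_functions \<Rightarrow> bool" where
  "sheaf_of_functions X \<longleftrightarrow>
     (\<forall>U f g. zopen X U \<and> regular X U f \<and> (\<forall>x\<in>U. f x = g x) \<longrightarrow> regular X U g) \<and>
     (\<forall>U V f. zopen X U \<and> zopen X V \<and> V \<subseteq> U \<and> regular X U f \<longrightarrow> regular X V f) \<and>
     (\<forall>U f. zopen X U \<and> (\<forall>x\<in>U. \<exists>V. zopen X V \<and> x \<in> V \<and> V \<subseteq> U \<and> regular X V f) \<longrightarrow>
            regular X U f) \<and>
     (\<forall>U c. zopen X U \<longrightarrow> regular X U (\<lambda>_. c)) \<and>
     (\<forall>U f g. zopen X U \<and> regular X U f \<and> regular X U g \<longrightarrow>
            regular X U (\<lambda>x. f x + g x) \<and> regular X U (\<lambda>x. f x * g x))"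

definition morphism ::
  "'a space_with_functions \<Rightarrow> 'b space_with_functions \<Rightarrow> ('a \<Rightarrow> 'b) \<Rightarrow> bool" where
  "morphism X Y \<phi> \<longleftrightarrow>
     continuous_map (zariski X) (zariski Y) \<phi> \<and>
     (\<forall>V f. zopen Y V \<and> regular Y V f \<longrightarrow> regular X {x \<in> points X. \<phi> x \<in> V} (f \<circ> \<phi>))"

definition isomorphism ::
  "'a space_with_functions \<Rightarrow> 'b space_with_functions \<Rightarrow> ('a \<Rightarrow> 'b) \<Rightarrow> bool" where
  "isomorphism X Y \<phi> \<longleftrightarrow>
     morphism X Y \<phi> \<and>
     (\<exists>\<psi>. morphism Y X \<psi> \<and> (\<forall>x\<in>points X. \<psi> (\<phi> x) = x) \<and> (\<forall>y\<in>points Y. \<phi> (\<psi> y) = y))"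

definition isomorphic_spaces :: "'a space_with_functions \<Rightarrow> 'b space_with_functions \<Rightarrow> bool" where
  "isomorphic_spaces X Y \<longleftrightarrow> (\<exists>\<phi>. isomorphism X Y \<phi>)"

definition open_subspace :: "'a space_with_functions \<Rightarrow> 'a set \<Rightarrow> 'a space_with_functions" where
  "open_subspace X U = \<lparr>zariski = subtopology (zariski X) U, regular = regular X\<rparr>"



text \<open>
  Points of affine \<open>n\<close>-space are sequences of complex numbers vanishing from index \<open>n\<close> on.
  Polynomials in \<open>n\<close> variables are represented by the functions they define, which loses nothing
  because the field of complex numbers is infinite.
\<close>

definition affine_space :: "nat \<Rightarrow> (nat \<Rightarrow> complex) set" where
  "affine_space n = {x. \<forall>i\<ge>n. x i = 0}"

inductive_set polynomials :: "nat \<Rightarrow> ((nat \<Rightarrow> complex) \<Rightarrow> complex) set" for n where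
  const: "(\<lambda>_. c) \<in> polynomials n"
| coord: "i < n \<Longrightarrow> (\<lambda>x. x i) \<in> polynomials n"
| add: "p \<in> polynomials n \<Longrightarrow> q \<in> polynomials n \<Longrightarrow> (\<lambda>x. p x + q x) \<in> polynomials n"
| mult: "p \<in> polynomials n \<Longrightarrow> q \<in> polynomials n \<Longrightarrow> (\<lambda>x. p x * q x) \<in> polynomials n"

definition affine_zariski :: "nat \<Rightarrow> (nat \<Rightarrow> complex) topology" where
  "affine_zariski n =
     topology_generated_by ((\<lambda>p. {x \<in> affine_space n. p x \<noteq> 0}) ` polynomials n)"

definition affine_variety :: "nat \<Rightarrow> (nat \<Rightarrow> complex) set \<Rightarrow> (nat \<Rightarrow> complex) space_with_functions"
  where
  "affine_variety n V =
     \<lparr>zariski = subtopology (affine_zariski n) V,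
      regular = (\<lambda>U f. \<forall>x\<in>U. \<exists>W. openin (subtopology (affine_zariski n) V) W \<and> x \<in> W \<and> W \<subseteq> U \<and>
        (\<exists>p\<in>polynomials n. \<exists>q\<in>polynomials n. \<forall>z\<in>W. q z \<noteq> 0 \<and> f z = p z / q z))\<rparr>"

definition is_affine :: "'a space_with_functions \<Rightarrow> bool" where
  "is_affine X \<longleftrightarrow>
     (\<exists>n V. closedin (affine_zariski n) V \<and> isomorphic_spaces X (affine_variety n V))"

definition affine_open :: "'a space_with_functions \<Rightarrow> 'a set \<Rightarrow> bool" where
  "affine_open X U \<longleftrightarrow> zopen X U \<and> is_affine (open_subspace X U)"



definition irreducible_subset :: "'a topology \<Rightarrow> 'a set \<Rightarrow> bool" where
  "irreducible_subset T Z \<longleftrightarrow>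
     Z \<noteq> {} \<and> Z \<subseteq> topspace T \<and>
     (\<forall>A B. closedin T A \<and> closedin T B \<and> Z \<subseteq> A \<union> B \<longrightarrow> Z \<subseteq> A \<or> Z \<subseteq> B)"

definition irreducible_component :: "'a topology \<Rightarrow> 'a set \<Rightarrow> 'a set \<Rightarrow> bool" where
  "irreducible_component T C Z \<longleftrightarrow>
     irreducible_subset T Z \<and> Z \<subseteq> C \<and>
     (\<forall>Z'. irreducible_subset T Z' \<and> Z \<subseteq> Z' \<and> Z' \<subseteq> C \<longrightarrow> Z' = Z)"

text \<open>
  The Zariski topology of the product \<open>X \<times> Y\<close>: locally, regular functions on the product are
  generated by the sums of products of regular functions on the factors, so their nonvanishing loci
  form a basis. It is finer than the product topology.
\<close>

definition product_zariski ::
  "'a space_with_functions \<Rightarrow> 'b space_with_functions \<Rightarrow> ('a \<times> 'b) topology" where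
  "product_zariski X Y =
     topology_generated_by
       {{(x, y). x \<in> U \<and> y \<in> V \<and> (\<Sum>i<k. f i x * g i y) \<noteq> 0} |U V (k::nat) f g.
          zopen X U \<and> zopen Y V \<and> (\<forall>i<k. regular X U (f i) \<and> regular Y V (g i))}"

definition separated :: "'a space_with_functions \<Rightarrow> bool" where
  "separated X \<longleftrightarrow> closedin (product_zariski X X) {(x, x) |x. x \<in> points X}"

definition variety :: "'a space_with_functions \<Rightarrow> bool" where
  "variety X \<longleftrightarrow>
     sheaf_of_functions X \<and>
     (\<exists>\<U>. finite \<U> \<and> (\<forall>U\<in>\<U>. affine_open X U) \<and> \<Union>\<U> = points X) \<and>
     irreducible_subset (zariski X) (points X) \<and>
     separated X"

text \<open>
  The Jacobian form of smoothness over the complex numbers: locally, \<open>X\<close> is the locus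
  \<open>f\<^sub>0 = \<dots> = f\<^bsub>c-1\<^esub> = 0\<close> in an affine space, with Jacobian matrix of rank \<open>c\<close> at each of its points.
  (Then the \<open>f\<^sub>j\<close> generate a radical ideal, so it does not matter that the locus is taken with its
  reduced structure.)
\<close>

definition standard_smooth :: "nat \<Rightarrow> nat \<Rightarrow> (nat \<Rightarrow> (nat \<Rightarrow> complex) \<Rightarrow> complex) \<Rightarrow> bool" where
  "standard_smooth n c f \<longleftrightarrow>
     (\<forall>j<c. f j \<in> polynomials n) \<and>
     (\<forall>x\<in>affine_space n. (\<forall>j<c. f j x = 0) \<longrightarrow>
        (\<forall>a. (\<forall>i<n. (\<Sum>j<c. a j * deriv (\<lambda>t. f j (x(i := t))) (x i)) = 0) \<longrightarrow> (\<forall>j<c. a j = 0)))"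

definition smooth :: "'a space_with_functions \<Rightarrow> bool" where
  "smooth X \<longleftrightarrow>
     (\<forall>p\<in>points X. \<exists>U n c f. zopen X U \<and> p \<in> U \<and> standard_smooth n c f \<and>
        isomorphic_spaces (open_subspace X U)
          (affine_variety n {x \<in> affine_space n. \<forall>j<c. f j x = 0}))"

text \<open>
  On an irreducible variety a rational function is a regular function on some nonempty open set,
  and every local ring is the ring of rational functions that are regular near the point.
  \<open>normal_variety X\<close> says that every local ring is integrally closed in the function field.
\<close>

definition normal_variety :: "'a space_with_functions \<Rightarrow> bool" where
  "normal_variety X \<longleftrightarrow>
     (\<forall>p\<in>points X. \<forall>U f W (n::nat) a.
        zopen X U \<and> U \<noteq> {} \<and> regular X U f \<and>
        zopen X W \<and> p \<in> W \<and> (\<forall>i<n. regular X W (a i)) \<and>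
        (\<forall>x\<in>U \<inter> W. f x ^ n + (\<Sum>i<n. a i x * f x ^ i) = 0) \<longrightarrow>
        (\<exists>W' g. zopen X W' \<and> p \<in> W' \<and> regular X W' g \<and> (\<forall>x\<in>U \<inter> W'. g x = f x)))"

definition prime_divisor :: "'a space_with_functions \<Rightarrow> 'a set \<Rightarrow> bool" where
  "prime_divisor Y D \<longleftrightarrow>
     closedin (zariski Y) D \<and> irreducible_subset (zariski Y) D \<and> D \<noteq> points Y \<and>
     (\<forall>Z. closedin (zariski Y) Z \<and> irreducible_subset (zariski Y) Z \<and> D \<subseteq> Z \<longrightarrow>
        Z = D \<or> Z = points Y)"

text \<open>A reduced divisor is a finite sum of distinct prime divisors, identified with its support.\<close>

definition reduced_divisor :: "'a space_with_functions \<Rightarrow> 'a set \<Rightarrow> bool" where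
  "reduced_divisor Y B \<longleftrightarrow> (\<exists>\<P>. finite \<P> \<and> (\<forall>D\<in>\<P>. prime_divisor Y D) \<and> B = \<Union>\<P>)"

text \<open>
  The classical topology is the coarsest one in which the Zariski open sets are open and all regular
  functions on them are continuous. On a subvariety of an affine space it is the Euclidean topology.
\<close>

definition classical :: "'a space_with_functions \<Rightarrow> 'a topology" where
  "classical X =
     topology_generated_by
       {{x \<in> U. f x \<in> S} |U f S. zopen X U \<and> regular X U f \<and> open S}"


section \<open>Fundamental groups and coverings\<close>

definition loops :: "'a topology \<Rightarrow> 'a \<Rightarrow> (real \<Rightarrow> 'a) set" where
  "loops T b = {p. pathin T p \<and> p 0 = b \<and> p 1 = b}"

definition loop_homotopic :: "'a topology \<Rightarrow> 'a \<Rightarrow> (real \<Rightarrow> 'a) \<Rightarrow> (real \<Rightarrow> 'a) \<Rightarrow> bool" where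
  "loop_homotopic T b = homotopic_with (\<lambda>r. r 0 = b \<and> r 1 = b) (top_of_set {0..1}) T"

definition loop_class :: "'a topology \<Rightarrow> 'a \<Rightarrow> (real \<Rightarrow> 'a) \<Rightarrow> (real \<Rightarrow> 'a) set" where
  "loop_class T b p = {q. loop_homotopic T b p q}"

text \<open>
  The library operations \<open>+++\<close> and \<open>reversepath\<close> need a topology on the type of points, which is
  not available here.
\<close>

definition path_join :: "(real \<Rightarrow> 'a) \<Rightarrow> (real \<Rightarrow> 'a) \<Rightarrow> real \<Rightarrow> 'a" where
  "path_join p q = (\<lambda>t. if t \<le> 1/2 then p (2 * t) else q (2 * t - 1))"

definition path_reverse :: "(real \<Rightarrow> 'a) \<Rightarrow> real \<Rightarrow> 'a" where
  "path_reverse p = (\<lambda>t. p (1 - t))"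

definition fundamental_group :: "'a topology \<Rightarrow> 'a \<Rightarrow> (real \<Rightarrow> 'a) set monoid" where
  "fundamental_group T b =
     \<lparr>carrier = loop_class T b ` loops T b,
      mult = (\<lambda>A B. {r. \<exists>p\<in>A. \<exists>q\<in>B. loop_homotopic T b (path_join p q) r}),
      one = loop_class T b (\<lambda>_. b)\<rparr>"

text \<open>
  The map of fundamental groups induced by \<open>f\<close>, from base point \<open>a\<close> to base point \<open>b\<close>, where the
  path \<open>\<gamma>\<close> from \<open>b\<close> to \<open>f a\<close> identifies the fundamental groups of the target at \<open>f a\<close> and at \<open>b\<close>.
\<close>

definition induced_map ::
  "'b topology \<Rightarrow> 'b \<Rightarrow> (real \<Rightarrow> 'b) \<Rightarrow> ('a \<Rightarrow> 'b) \<Rightarrow> (real \<Rightarrow> 'a) set \<Rightarrow> (real \<Rightarrow> 'b) set" where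
  "induced_map T b \<gamma> f A =
     {r. \<exists>p\<in>A. loop_homotopic T b (path_join \<gamma> (path_join (f \<circ> p) (path_reverse \<gamma>))) r}"

definition covering_map :: "'a topology \<Rightarrow> 'b topology \<Rightarrow> ('a \<Rightarrow> 'b) \<Rightarrow> bool" where
  "covering_map S T p \<longleftrightarrow>
     continuous_map S T p \<and> p ` topspace S = topspace T \<and>
     (\<forall>y\<in>topspace T. \<exists>U. openin T U \<and> y \<in> U \<and>
        (\<exists>\<V>. (\<forall>V\<in>\<V>. openin S V) \<and> disjoint \<V> \<and> \<Union>\<V> = {x \<in> topspace S. p x \<in> U} \<and>
             (\<forall>V\<in>\<V>. homeomorphic_map (subtopology S V) (subtopology T U) p)))"


section \<open>Galois covers\<close>

definition finite_morphism ::
  "'b space_with_functions \<Rightarrow> 'a space_with_functions \<Rightarrow> ('b \<Rightarrow> 'a) \<Rightarrow> bool" where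
  "finite_morphism X Y \<phi> \<longleftrightarrow>
     morphism X Y \<phi> \<and>
     (\<forall>y\<in>points Y. \<exists>V U. affine_open Y V \<and> y \<in> V \<and> U = {x \<in> points X. \<phi> x \<in> V} \<and>
        affine_open X U \<and>
        (\<exists>(m::nat) g. (\<forall>i<m. regular X U (g i)) \<and>
           (\<forall>f. regular X U f \<longrightarrow>
              (\<exists>a. (\<forall>i<m. regular Y V (a i)) \<and> (\<forall>x\<in>U. f x = (\<Sum>i<m. a i (\<phi> x) * g i x))))))"

text \<open>
  A finite cover is Galois if its covering transformations, i.e. the automorphisms of \<open>X\<close> over \<open>Y\<close>,
  act transitively on each fibre.
\<close>

definition galois_cover ::
  "'b space_with_functions \<Rightarrow> 'a space_with_functions \<Rightarrow> ('b \<Rightarrow> 'a) \<Rightarrow> bool" where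
  "galois_cover X Y \<phi> \<longleftrightarrow>
     finite_morphism X Y \<phi> \<and> \<phi> ` points X = points Y \<and>
     (\<forall>x\<in>points X. \<forall>x'\<in>points X. \<phi> x = \<phi> x' \<longrightarrow>
        (\<exists>\<tau>. isomorphism X X \<tau> \<and> (\<forall>z\<in>points X. \<phi> (\<tau> z) = \<phi> z) \<and> \<tau> x = x'))"

text \<open>
  \<open>\<phi>\<close> is unramified at \<open>x\<close> if the maximal ideal of the local ring at \<open>\<phi> x\<close> generates the maximal
  ideal of the local ring at \<open>x\<close>; the residue fields are both the field of complex numbers.
\<close>

definition unramified_at ::
  "'b space_with_functions \<Rightarrow> 'a space_with_functions \<Rightarrow> ('b \<Rightarrow> 'a) \<Rightarrow> 'b \<Rightarrow> bool" where
  "unramified_at X Y \<phi> x \<longleftrightarrow>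
     (\<forall>W g. zopen X W \<and> x \<in> W \<and> regular X W g \<and> g x = 0 \<longrightarrow>
        (\<exists>W' V (k::nat) a f.
           zopen X W' \<and> x \<in> W' \<and> W' \<subseteq> W \<and> zopen Y V \<and> \<phi> ` W' \<subseteq> V \<and>
           (\<forall>i<k. regular X W' (a i) \<and> regular Y V (f i) \<and> f i (\<phi> x) = 0) \<and>
           (\<forall>z\<in>W'. g z = (\<Sum>i<k. a i z * f i (\<phi> z)))))"

definition complement :: "'a space_with_functions \<Rightarrow> 'a set \<Rightarrow> 'a topology" where
  "complement Y B = subtopology (classical Y) (points Y - B)"

definition cover_complement ::
  "'b space_with_functions \<Rightarrow> 'a space_with_functions \<Rightarrow> ('b \<Rightarrow> 'a) \<Rightarrow> 'a set \<Rightarrow> 'b topology" where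
  "cover_complement X Y \<phi> B = subtopology (classical X) {x \<in> points X. \<phi> x \<in> points Y - B}"

text \<open>
  \<open>\<phi> : X \<rightarrow> Y\<close> is the \<open>G\<close>-cover induced by \<open>\<theta>\<close>, where \<open>\<theta>\<close> is defined on the fundamental group of
  \<open>Y - B\<close> at \<open>b\<close>.
\<close>

definition induced_cover ::
  "'b space_with_functions \<Rightarrow> 'a space_with_functions \<Rightarrow> ('b \<Rightarrow> 'a) \<Rightarrow> 'a set \<Rightarrow> 'a \<Rightarrow>
   'g monoid \<Rightarrow> ((real \<Rightarrow> 'a) set \<Rightarrow> 'g) \<Rightarrow> bool" where
  "induced_cover X Y \<phi> B b G \<theta> \<longleftrightarrow>
     variety X \<and> normal_variety X \<and> galois_cover X Y \<phi> \<and>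
     (\<forall>x\<in>points X. \<phi> x \<notin> B \<longrightarrow> unramified_at X Y \<phi> x) \<and>
     covering_map (cover_complement X Y \<phi> B) (complement Y B) \<phi> \<and>
     connected_space (cover_complement X Y \<phi> B) \<and>
     (\<exists>x. x \<in> points X \<and> \<phi> x = b \<and>
        induced_map (complement Y B) b (\<lambda>_. b) \<phi> `
          carrier (fundamental_group (cover_complement X Y \<phi> B) x) =
        kernel (fundamental_group (complement Y B) b) G \<theta>)"

text \<open>
  For a finite covering, the preimage of a connected set has only finitely many connected
  components, so \<open>card\<close> gives their actual number.
\<close>

definition connected_number ::
  "'b space_with_functions \<Rightarrow> ('b \<Rightarrow> 'a) \<Rightarrow> 'a set \<Rightarrow> 'a set \<Rightarrow> nat" where
  "connected_number X \<phi> B C =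
     card (connected_components_of (subtopology (classical X) {x \<in> points X. \<phi> x \<in> C - B}))"

end

theory Submission
  imports Defs
begin

text \<open>
  The condition \<open>\<sigma> \<circ> \<theta>\<^sub>2 \<circ> h\<^sub>* = \<theta>\<^sub>1\<close> says that \<open>h\<^sub>*\<close> carries \<open>ker \<theta>\<^sub>1\<close> to \<open>ker \<theta>\<^sub>2\<close>. The covering of \<open>Y - B\<^sub>i\<close>
  given by \<open>\<phi>\<^sub>i\<close> corresponds to \<open>ker \<theta>\<^sub>i\<close>, so by the lifting criterion \<open>h\<close> lifts to a homeomorphism
  between the two coverings. It maps the preimage of \<open>C\<^sub>1 - B\<^sub>1\<close> onto that of \<open>C\<^sub>2 - B\<^sub>2\<close>, whence the
  numbers of connected components agree.

  The lifting criterion needs \<open>Y\<close> to be locally path-connected in the classical topology, and this is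
  where smoothness enters. Near a point \<open>p\<close> of the locus \<open>f = 0\<close>, whose Jacobian at \<open>p\<close> has a right
  inverse \<open>R\<close>, a nearby point \<open>z\<close> of the locus is joined to \<open>p\<close> by correcting the segment: the path
  is \<open>p + t (z - p) + R u(t)\<close>, where \<open>u(t)\<close> is the unique small zero of
  \<open>u \<mapsto> f (p + t (z - p) + R u)\<close>.
\<close>

section \<open>Lifting in covering spaces\<close>

lemma covering_map_imp_continuous: "covering_map E T q \<Longrightarrow> continuous_map E T q"
  by (simp add: covering_map_def)

text \<open>
  The last clause stands in for the disjointness of the sheets over \<open>U\<close>.
\<close>

definition sheet_over ::
  "'b topology \<Rightarrow> 'a topology \<Rightarrow> ('b \<Rightarrow> 'a) \<Rightarrow> 'a set \<Rightarrow> 'b set \<Rightarrow> ('a \<Rightarrow> 'b) \<Rightarrow> bool" where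
  "sheet_over E T q U V s \<longleftrightarrow>
     openin E V \<and> continuous_map (subtopology T U) E s \<and>
     (\<forall>y\<in>U. s y \<in> V \<and> q (s y) = y) \<and> (\<forall>x\<in>V. q x \<in> U \<and> s (q x) = x) \<and>
     (\<forall>A. connectedin E A \<and> q ` A \<subseteq> U \<and> A \<inter> V \<noteq> {} \<longrightarrow> A \<subseteq> V)"

lemma sheet_overD:
  assumes "sheet_over E T q U V s"
  shows "openin E V" and "continuous_map (subtopology T U) E s"
    and "y \<in> U \<Longrightarrow> s y \<in> V" and "y \<in> U \<Longrightarrow> q (s y) = y"
    and "x \<in> V \<Longrightarrow> q x \<in> U" and "x \<in> V \<Longrightarrow> s (q x) = x"
    and "connectedin E A \<Longrightarrow> q ` A \<subseteq> U \<Longrightarrow> A \<inter> V \<noteq> {} \<Longrightarrow> A \<subseteq> V"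
  using assms by (simp_all add: sheet_over_def)

lemma sheet_over_openin:
  assumes V: "sheet_over E T q U V s" and U: "openin T U" and W: "openin E W"
  shows "openin T {y \<in> U. s y \<in> W}"
proof -
  have "topspace (subtopology T U) = U" using openin_subset[OF U] by auto
  then have "openin (subtopology T U) {y \<in> U. s y \<in> W}"
    using openin_continuous_map_preimage[OF sheet_overD(2)[OF V] W] by metis
  then show ?thesis using U by (simp add: openin_open_subtopology)
qed

lemma evenly_covered_nhd:
  assumes "covering_map E T q" and "y \<in> topspace T"
  obtains U where "openin T U" and "y \<in> U"
    and "\<And>e. e \<in> topspace E \<Longrightarrow> q e \<in> U \<Longrightarrow> \<exists>V s. e \<in> V \<and> sheet_over E T q U V s"
proof -
  obtain U \<V> where U: "openin T U" "y \<in> U" and \<V>: "\<forall>V\<in>\<V>. openin E V" "disjoint \<V>"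
      "\<Union>\<V> = {x \<in> topspace E. q x \<in> U}"
      "\<forall>V\<in>\<V>. homeomorphic_map (subtopology E V) (subtopology T U) q"
    using assms unfolding covering_map_def by meson
  show thesis
  proof (rule that[OF U])
    fix e assume "e \<in> topspace E" "q e \<in> U"
    then obtain V where V: "V \<in> \<V>" "e \<in> V" using \<V>(3) by blast
    have VE: "topspace E \<inter> V = V" and UT: "topspace T \<inter> U = U"
      using V(1) \<V>(1) U(1) openin_subset by blast+
    obtain s where s: "homeomorphic_maps (subtopology E V) (subtopology T U) q s"
      using \<V>(4) V homeomorphic_map_maps by blast
    have "A \<subseteq> V" if A: "connectedin E A" "q ` A \<subseteq> U" "A \<inter> V \<noteq> {}" for A
    proof -
      have "A \<subseteq> \<Union>\<V>"
        using A(1,2) \<V>(3) connectedin_subset_topspace by fastforce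
      then have sub: "A \<subseteq> V \<union> \<Union>(\<V> - {V})" by blast
      moreover have "openin E V" "openin E (\<Union>(\<V> - {V}))" using \<V>(1) V by auto
      moreover have "V \<inter> \<Union>(\<V> - {V}) = {}"
        using \<V>(2) V by (auto simp: disjoint_def)
      ultimately have "A \<inter> V = {} \<or> A \<inter> \<Union>(\<V> - {V}) = {}"
        using A(1) unfolding connectedin by blast
      with A(3) sub show ?thesis by blast
    qed
    moreover have "continuous_map (subtopology T U) E s"
      using s continuous_map_into_fulltopology unfolding homeomorphic_maps_def by blast
    moreover have "\<forall>y\<in>U. s y \<in> V \<and> q (s y) = y" "\<forall>x\<in>V. q x \<in> U \<and> s (q x) = x"
      using s VE UT by (auto simp: homeomorphic_maps_def continuous_map_def Pi_iff)
    ultimately have "sheet_over E T q U V s"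
      using V(1) \<V>(1) unfolding sheet_over_def by blast
    with V(2) show "\<exists>V s. e \<in> V \<and> sheet_over E T q U V s" by blast
  qed
qed

lemma continuous_map_into_open_nhd:
  fixes S :: "'r::metric_space set"
  assumes "continuous_map (top_of_set S) T f" and "x \<in> S" and "openin T U" and "f x \<in> U"
  obtains d where "0 < d" and "\<And>t. t \<in> S \<Longrightarrow> dist t x < d \<Longrightarrow> f t \<in> U"
proof -
  have "openin (top_of_set S) {t \<in> S. f t \<in> U}"
    using openin_continuous_map_preimage[OF assms(1,3)] by simp
  then obtain d where "d > 0" "\<forall>t\<in>S. dist t x < d \<longrightarrow> t \<in> {t \<in> S. f t \<in> U}"
    unfolding openin_euclidean_subtopology_iff using assms(2,4) by auto
  with that show thesis by auto
qed

lemma continuous_map_subinterval: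
  fixes a b c d :: real
  assumes "continuous_map (top_of_set {a..b}) T f" and "a \<le> c" and "d \<le> b"
  shows "continuous_map (top_of_set {c..d}) T f"
  using continuous_map_from_subtopology_mono[OF assms(1), of "{c..d}"] assms(2,3) by auto

lemma connectedin_interval_image:
  fixes a b c d :: real
  assumes "continuous_map (top_of_set {a..b}) T f" and "a \<le> c" and "d \<le> b"
  shows "connectedin T (f ` {c..d})"
proof (rule connectedin_continuous_map_image[OF continuous_map_subinterval[OF assms]])
  show "connectedin (top_of_set {c..d}) {c..d}"
    by (simp add: connectedin_subtopology)
qed

lemma continuous_map_interval_in:
  fixes a b :: real
  assumes "continuous_map (top_of_set {a..b}) T f" and "t \<in> {a..b}"
  shows "f t \<in> topspace T"
  using assms by (auto simp: continuous_map_def Pi_iff)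

lemma sheet_over_interval:
  fixes a b u v :: real
  assumes V: "sheet_over E T q U V s" and g: "continuous_map (top_of_set {a..b}) E g"
    and "a \<le> u" "u \<le> v" "v \<le> b" and "g u \<in> V" and U: "\<And>t. t \<in> {u..v} \<Longrightarrow> q (g t) \<in> U"
  shows "g v \<in> V"
proof -
  have "g u \<in> g ` {u..v} \<inter> V" "q ` g ` {u..v} \<subseteq> U" using assms(4,6) U by auto
  then have "g ` {u..v} \<subseteq> V"
    using sheet_overD(7)[OF V connectedin_interval_image[OF g assms(3,5)]] by blast
  then show ?thesis using assms(4) by auto
qed

lemma covering_lift_exists:
  fixes a b :: real
  assumes cov: "covering_map E T q" and f: "continuous_map (top_of_set {a..b}) T f" and ab: "a \<le> b"
    and e: "e \<in> topspace E" "q e = f a"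
  shows "\<exists>g. continuous_map (top_of_set {a..b}) E g \<and> g a = e \<and> (\<forall>t\<in>{a..b}. q (g t) = f t)"
proof -
  define P where "P c d \<longleftrightarrow> (a \<le> c \<and> c \<le> d \<and> d \<le> b \<longrightarrow> (\<forall>e\<in>topspace E. q e = f c \<longrightarrow>
     (\<exists>g. continuous_map (top_of_set {c..d}) E g \<and> g c = e \<and> (\<forall>t\<in>{c..d}. q (g t) = f t))))" for c d
  have "P a b" using ab
  proof (induction rule: Bolzano)
    case (trans u v w)
    show ?case
      unfolding P_def
    proof (intro impI ballI)
      fix e assume uw: "a \<le> u \<and> u \<le> w \<and> w \<le> b" and e: "e \<in> topspace E" "q e = f u"
      obtain g where g: "continuous_map (top_of_set {u..v}) E g" "g u = e" "\<forall>t\<in>{u..v}. q (g t) = f t"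
        using trans uw e unfolding P_def by force
      have "g v \<in> topspace E" "q (g v) = f v"
        using g(3) trans(3) continuous_map_interval_in[OF g(1)] by auto
      then obtain k where k: "continuous_map (top_of_set {v..w}) E k" "k v = g v" "\<forall>t\<in>{v..w}. q (k t) = f t"
        using trans uw unfolding P_def by force
      let ?j = "\<lambda>t. if t \<le> v then g t else k t"
      have "continuous_map (top_of_set {u..w}) E ?j"
      proof (rule continuous_map_cases_le)
        have "{u..w} \<inter> {x \<in> {u..w}. x \<le> v} = {u..v}" "{u..w} \<inter> {x \<in> {u..w}. v \<le> x} = {v..w}"
          using trans by auto
        then show "continuous_map (subtopology (top_of_set {u..w}) {x \<in> topspace (top_of_set {u..w}). x \<le> v}) E g"
          "continuous_map (subtopology (top_of_set {u..w}) {x \<in> topspace (top_of_set {u..w}). v \<le> x}) E k"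
          using g k by (simp_all add: subtopology_subtopology)
      qed (use k in auto)
      moreover have "?j u = e" "\<forall>t\<in>{u..w}. q (?j t) = f t" using g k trans by auto
      ultimately show "\<exists>g. continuous_map (top_of_set {u..w}) E g \<and> g u = e \<and> (\<forall>t\<in>{u..w}. q (g t) = f t)"
        by blast
    qed
  next
    case (local x)
    then have "f x \<in> topspace T" using continuous_map_interval_in[OF f] by auto
    then obtain U where U: "openin T U" "f x \<in> U"
      and sh: "\<And>e. e \<in> topspace E \<Longrightarrow> q e \<in> U \<Longrightarrow> \<exists>V s. e \<in> V \<and> sheet_over E T q U V s"
      using evenly_covered_nhd[OF cov] by metis
    obtain d where d: "0 < d" "\<And>t. t \<in> {a..b} \<Longrightarrow> dist t x < d \<Longrightarrow> f t \<in> U"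
      using continuous_map_into_open_nhd[OF f _ U] local by auto
    have "P u v" if uv: "u \<le> x \<and> x \<le> v \<and> v - u < d" for u v
      unfolding P_def
    proof (intro impI ballI)
      fix e assume *: "a \<le> u \<and> u \<le> v \<and> v \<le> b" and e: "e \<in> topspace E" "q e = f u"
      have fU: "f t \<in> U" if "t \<in> {u..v}" for t using that uv * by (intro d) (auto simp: dist_real_def)
      obtain V s where V: "e \<in> V" "sheet_over E T q U V s"
        using sh[OF e(1)] e(2) fU[of u] * by auto
      have "continuous_map (top_of_set {u..v}) (subtopology T U) f"
        using continuous_map_subinterval[OF f] * fU by (auto simp: continuous_map_in_subtopology)
      then have "continuous_map (top_of_set {u..v}) E (s \<circ> f)"
        using sheet_overD(2)[OF V(2)] continuous_map_compose by blast
      moreover have "s (f u) = e" using sheet_overD(6)[OF V(2,1)] e by simp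
      ultimately show "\<exists>g. continuous_map (top_of_set {u..v}) E g \<and> g u = e \<and> (\<forall>t\<in>{u..v}. q (g t) = f t)"
        using fU sheet_overD(4)[OF V(2)] by (intro exI[of _ "s \<circ> f"]) auto
    qed
    then show ?case using d(1) by blast
  qed
  then show ?thesis using e ab unfolding P_def by blast
qed

lemma covering_lift_unique:
  fixes a b :: real
  assumes cov: "covering_map E T q"
    and g: "continuous_map (top_of_set {a..b}) E g" and g': "continuous_map (top_of_set {a..b}) E g'"
    and eq: "\<And>t. t \<in> {a..b} \<Longrightarrow> q (g t) = q (g' t)" and a: "g a = g' a" and t: "t \<in> {a..b}"
  shows "g t = g' t"
proof -
  define P where "P c d \<longleftrightarrow> (a \<le> c \<and> c \<le> d \<and> d \<le> b \<and> g c = g' c \<longrightarrow> g d = g' d)" for c d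
  have "a \<le> t" using t by auto
  then have "P a t"
  proof (induction rule: Bolzano)
    case (local x)
    then have x: "x \<in> {a..b}" using t by auto
    have qg: "continuous_map (top_of_set {a..b}) T (q \<circ> g)"
      by (rule continuous_map_compose[OF g covering_map_imp_continuous[OF cov]])
    then have "(q \<circ> g) x \<in> topspace T" using x continuous_map_interval_in by blast
    then obtain U where U: "openin T U" "(q \<circ> g) x \<in> U"
      and sh: "\<And>e. e \<in> topspace E \<Longrightarrow> q e \<in> U \<Longrightarrow> \<exists>V s. e \<in> V \<and> sheet_over E T q U V s"
      using evenly_covered_nhd[OF cov] by metis
    obtain d where d: "0 < d" "\<And>t. t \<in> {a..b} \<Longrightarrow> dist t x < d \<Longrightarrow> (q \<circ> g) t \<in> U"
      using continuous_map_into_open_nhd[OF qg x U] by auto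
    have "P u v" if uv: "u \<le> x \<and> x \<le> v \<and> v - u < d" for u v
      unfolding P_def
    proof (intro impI)
      assume *: "a \<le> u \<and> u \<le> v \<and> v \<le> b \<and> g u = g' u"
      have fU: "q (g t) \<in> U" "q (g' t) \<in> U" if "t \<in> {u..v}" for t
        using d(2)[of t] eq[of t] that uv * by (auto simp: dist_real_def)
      have "g u \<in> topspace E" using continuous_map_interval_in[OF g, of u] * by simp
      then obtain V s where V: "g u \<in> V" "sheet_over E T q U V s"
        using sh[of "g u"] fU(1)[of u] * by auto
      have "g v \<in> V" by (rule sheet_over_interval[OF V(2) g]) (use * V(1) fU in auto)
      moreover have "g' v \<in> V" by (rule sheet_over_interval[OF V(2) g']) (use * V(1) fU in auto)
      ultimately have "g v = s (q (g v))" "g' v = s (q (g' v))"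
        using sheet_overD(6)[OF V(2)] by simp_all
      then show "g v = g' v" using eq[of v] * by simp
    qed
    then show ?case using d(1) by blast
  qed (auto simp: P_def)
  then show ?thesis using t a by (auto simp: P_def)
qed

lemma covering_lift_endpoint_continuous:
  assumes cov: "covering_map E T q"
    and K: "continuous_map (prod_topology (top_of_set {0..1}) (top_of_set {0..1::real})) T K"
    and g: "\<And>s. s \<in> {0..1::real} \<Longrightarrow> pathin E (g s)"
    and lift: "\<And>s t. s \<in> {0..1} \<Longrightarrow> t \<in> {0..1} \<Longrightarrow> q (g s t) = K (s, t)"
    and start: "\<And>s. s \<in> {0..1} \<Longrightarrow> g s 0 = e"
  shows "pathin E (\<lambda>s. g s 1)"
proof -
  have gc: "continuous_map (top_of_set {0..1}) E (g s)" if "s \<in> {0..1}" for s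
    using g[OF that] by (simp add: pathin_def)
  have K': "continuous_map (top_of_set ({0..1} \<times> {0..1})) T K"
    using K by (simp add: prod_topology_subtopology subtopology_subtopology Times_Int_Times)
  have main: "\<exists>\<delta>>0. \<forall>s\<in>{0..1}. \<bar>s - s0\<bar> < \<delta> \<longrightarrow> g s 1 \<in> W"
    if s0: "s0 \<in> {0..1}" and W: "openin E W" "g s0 1 \<in> W" for s0 W
  proof -
    \<comment> \<open>Quantifying over all neighbourhoods makes this property of intervals transitive, as \<open>Bolzano\<close> needs.\<close>
    define P where "P c d \<longleftrightarrow> (0 \<le> c \<and> c \<le> d \<and> d \<le> 1 \<longrightarrow>
      (\<forall>W'. openin E W' \<and> g s0 d \<in> W' \<longrightarrow> (\<exists>W \<delta>. openin E W \<and> g s0 c \<in> W \<and> \<delta> > 0 \<and>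
        (\<forall>s\<in>{0..1}. \<bar>s - s0\<bar> < \<delta> \<and> g s c \<in> W \<longrightarrow> g s d \<in> W'))))" for c d
    have "P 0 1" using zero_le_one
    proof (induction rule: Bolzano)
      case (trans u v w)
      show ?case
        unfolding P_def
      proof (intro allI impI)
        fix W' assume uw: "0 \<le> u \<and> u \<le> w \<and> w \<le> 1" and "openin E W' \<and> g s0 w \<in> W'"
        then obtain W1 \<delta>1 where 1: "openin E W1" "g s0 v \<in> W1" "\<delta>1 > 0"
          "\<forall>s\<in>{0..1}. \<bar>s - s0\<bar> < \<delta>1 \<and> g s v \<in> W1 \<longrightarrow> g s w \<in> W'"
          using trans unfolding P_def by (metis order_trans)
        then obtain W2 \<delta>2 where 2: "openin E W2" "g s0 u \<in> W2" "\<delta>2 > 0"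
          "\<forall>s\<in>{0..1}. \<bar>s - s0\<bar> < \<delta>2 \<and> g s u \<in> W2 \<longrightarrow> g s v \<in> W1"
          using trans uw unfolding P_def by (metis order_trans)
        show "\<exists>W \<delta>. openin E W \<and> g s0 u \<in> W \<and> \<delta> > 0 \<and>
            (\<forall>s\<in>{0..1}. \<bar>s - s0\<bar> < \<delta> \<and> g s u \<in> W \<longrightarrow> g s w \<in> W')"
          using 1 2 by (intro exI[of _ W2] exI[of _ "min \<delta>1 \<delta>2"]) auto
      qed
    next
      case (local x)
      then have x: "(s0, x) \<in> {0..1} \<times> {0..1}" using s0 by auto
      then have "K (s0, x) \<in> topspace T" using K' by (auto simp: continuous_map_def Pi_iff)
      then obtain U where U: "openin T U" "K (s0, x) \<in> U"
        and sh: "\<And>e. e \<in> topspace E \<Longrightarrow> q e \<in> U \<Longrightarrow> \<exists>V s. e \<in> V \<and> sheet_over E T q U V s"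
        using evenly_covered_nhd[OF cov] by metis
      obtain d0 where d0: "0 < d0" "\<And>z. z \<in> {0..1} \<times> {0..1} \<Longrightarrow> dist z (s0, x) < d0 \<Longrightarrow> K z \<in> U"
        using continuous_map_into_open_nhd[OF K' x U] by metis
      define d where "d = d0 / 2"
      have d: "0 < d" "\<And>s t. s \<in> {0..1} \<Longrightarrow> t \<in> {0..1} \<Longrightarrow> \<bar>s - s0\<bar> < d \<Longrightarrow> \<bar>t - x\<bar> < d \<Longrightarrow> K (s, t) \<in> U"
      proof -
        show "0 < d" using d0 by (simp add: d_def)
        fix s t assume *: "s \<in> {0..1}" "t \<in> {0..1}" "\<bar>s - s0\<bar> < d" "\<bar>t - x\<bar> < d"
        have "dist (s, t) (s0, x) \<le> \<bar>s - s0\<bar> + \<bar>t - x\<bar>"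
          unfolding dist_Pair_Pair dist_real_def
          using sqrt_sum_squares_le_sum_abs[of "\<bar>s - s0\<bar>" "\<bar>t - x\<bar>"] by simp
        then show "K (s, t) \<in> U" using * by (intro d0(2)) (auto simp: d_def)
      qed
      have "P u v" if uv: "u \<le> x \<and> x \<le> v \<and> v - u < d" for u v
        unfolding P_def
      proof (intro allI impI)
        fix W' assume *: "0 \<le> u \<and> u \<le> v \<and> v \<le> 1" and W': "openin E W' \<and> g s0 v \<in> W'"
        have gU: "q (g s t) \<in> U" if "s \<in> {0..1}" "\<bar>s - s0\<bar> < d" "t \<in> {u..v}" for s t
          using lift[of s t] d(2)[of s t] uv * that by auto
        have "g s0 u \<in> topspace E" using continuous_map_interval_in[OF gc[OF s0]] * by auto
        moreover have "q (g s0 u) \<in> U" by (rule gU) (use s0 d * in auto)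
        ultimately obtain V r where V: "g s0 u \<in> V" "sheet_over E T q U V r"
          using sh by meson
        have gV: "g s v \<in> V" if "s \<in> {0..1}" "\<bar>s - s0\<bar> < d" "g s u \<in> V" for s
          by (rule sheet_over_interval[OF V(2) gc[OF that(1)]]) (use * that gU in auto)
        have rK: "r (K (s, v)) = g s v" if "s \<in> {0..1}" "\<bar>s - s0\<bar> < d" "g s u \<in> V" for s
          using sheet_overD(6)[OF V(2) gV[OF that]] lift[of s v] that(1) * by simp
        let ?O = "{y \<in> U. r y \<in> W'}"
        have "openin T ?O" using sheet_over_openin[OF V(2) U(1)] W' by blast
        moreover have "continuous_map (top_of_set {0..1}) T (\<lambda>s. K (s, v))"
          using continuous_map_compose[of "top_of_set {0..1}" _ "\<lambda>s. (s, v)", OF _ K] *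
          by (simp add: continuous_map_pairwise o_def continuous_on_Pair)
        moreover have "K (s0, v) \<in> ?O"
          using rK[OF s0] V(1) d(1) W' gU[OF s0, of v] lift[OF s0, of v] * by auto
        ultimately obtain \<delta> where \<delta>: "\<delta> > 0" "\<And>s. s \<in> {0..1} \<Longrightarrow> dist s s0 < \<delta> \<Longrightarrow> K (s, v) \<in> ?O"
          using continuous_map_into_open_nhd[of "{0..1}" T "\<lambda>s. K (s, v)" s0 ?O] s0 by blast
        show "\<exists>W \<delta>. openin E W \<and> g s0 u \<in> W \<and> \<delta> > 0 \<and>
            (\<forall>s\<in>{0..1}. \<bar>s - s0\<bar> < \<delta> \<and> g s u \<in> W \<longrightarrow> g s v \<in> W')"
          using V(1) sheet_overD(1)[OF V(2)] \<delta> d(1) rK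
          by (intro exI[of _ V] exI[of _ "min d \<delta>"]) (force simp: dist_real_def)
      qed
      then show ?case using d(1) by blast
    qed
    then obtain W1 \<delta> where "openin E W1" "g s0 0 \<in> W1" "\<delta> > 0"
      "\<forall>s\<in>{0..1}. \<bar>s - s0\<bar> < \<delta> \<and> g s 0 \<in> W1 \<longrightarrow> g s 1 \<in> W"
      using W unfolding P_def by force
    then show ?thesis using start[OF s0] start by (intro exI[of _ \<delta>]) auto
  qed
  have "openin (top_of_set {0..1}) {s \<in> {0..1}. g s 1 \<in> W}" if "openin E W" for W
    unfolding openin_euclidean_subtopology_iff using main[OF _ that] by (auto simp: dist_real_def)
  moreover have "g s 1 \<in> topspace E" if "s \<in> {0..1}" for s
    using continuous_map_interval_in[OF gc[OF that]] by auto
  ultimately show ?thesis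
    unfolding pathin_def continuous_map_def by auto
qed

lemma homotopic_loops_lift_endpoint:
  assumes cov: "covering_map E T q" and hom: "loop_homotopic T b p p'"
    and g: "pathin E g" "\<And>t. t \<in> {0..1} \<Longrightarrow> q (g t) = p t"
    and g': "pathin E g'" "\<And>t. t \<in> {0..1} \<Longrightarrow> q (g' t) = p' t"
    and start: "g 0 = g' 0"
  shows "g 1 = g' 1"
proof -
  obtain K where K: "continuous_map (prod_topology (top_of_set {0..1}) (top_of_set {0..1::real})) T K"
    "\<And>x. K (0, x) = p x" "\<And>x. K (1, x) = p' x" "\<And>s. s \<in> {0..1::real} \<Longrightarrow> K (s, 0) = b \<and> K (s, 1) = b"
    using hom unfolding loop_homotopic_def homotopic_with_def by auto
  have e: "g 0 \<in> topspace E" "q (g 0) = b"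
    using path_start_in_topspace[OF g(1)] g(2)[of 0] K(2)[of 0] K(4)[of 0] by auto
  have "\<exists>k. pathin E k \<and> k 0 = g 0 \<and> (\<forall>t\<in>{0..1}. q (k t) = K (s, t))" if s: "s \<in> {0..1}" for s
  proof -
    have "continuous_map (top_of_set {0..1}) T (\<lambda>t. K (s, t))"
      using continuous_map_compose[of "top_of_set {0..1}" _ "\<lambda>t. (s, t)", OF _ K(1)] s
      by (simp add: continuous_map_pairwise o_def continuous_on_Pair)
    then show ?thesis
      using covering_lift_exists[OF cov _ zero_le_one e(1), of "\<lambda>t. K (s, t)"] e(2) K(4)[OF s]
      by (simp add: pathin_def)
  qed
  then obtain k where k: "\<And>s. s \<in> {0..1} \<Longrightarrow> pathin E (k s)" "\<And>s. s \<in> {0..1} \<Longrightarrow> k s 0 = g 0"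
    "\<And>s t. s \<in> {0..1} \<Longrightarrow> t \<in> {0..1} \<Longrightarrow> q (k s t) = K (s, t)"
    by metis
  have "pathin E (\<lambda>s. k s 1)"
    by (rule covering_lift_endpoint_continuous[OF cov K(1)]) (use k in auto)
  moreover have "k 0 1 \<in> topspace E" using k(1)[of 0] path_finish_in_topspace by force
  ultimately have "k 1 1 = k 0 1"
    using covering_lift_unique[OF cov, of 0 1 "\<lambda>s. k s 1" "\<lambda>_. k 0 1" 1] k(3)[of _ 1] K(4)
    by (simp add: pathin_def)
  moreover have "k 0 1 = g 1"
    using covering_lift_unique[OF cov, of 0 1 "k 0" g 1] k(1)[of 0] k(2)[of 0] k(3)[of 0] g K(2)
    by (simp add: pathin_def)
  moreover have "k 1 1 = g' 1"
    using covering_lift_unique[OF cov, of 0 1 "k 1" g' 1] k(1)[of 1] k(2)[of 1] k(3)[of 1] g' K(3) start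
    by (simp add: pathin_def)
  ultimately show ?thesis by simp
qed

lemma pathin_reparam:
  assumes "pathin T p" and "continuous_on {0..1} \<rho>" and "\<And>t. t \<in> {0..1} \<Longrightarrow> \<rho> t \<in> {0..1}"
  shows "pathin T (\<lambda>t. p (\<rho> t))"
proof -
  have "continuous_map (top_of_set {0..1}) (top_of_set {0..1}) \<rho>"
    using assms(2,3) by auto
  then show ?thesis
    using continuous_map_compose assms(1) unfolding pathin_def o_def by blast
qed

lemma homotopic_path_join:
  assumes p: "homotopic_with (\<lambda>r. r 0 = a \<and> r 1 = b) (top_of_set {0..1::real}) T p p'"
    and q: "homotopic_with (\<lambda>r. r 0 = b \<and> r 1 = c) (top_of_set {0..1::real}) T q q'"
  shows "homotopic_with (\<lambda>r. r 0 = a \<and> r 1 = c) (top_of_set {0..1::real}) T (path_join p q) (path_join p' q')"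
proof -
  let ?I = "{0..1::real}"
  have II: "prod_topology (top_of_set ?I) (top_of_set ?I) = top_of_set (?I \<times> ?I)"
    by (simp add: prod_topology_subtopology subtopology_subtopology Times_Int_Times)
  obtain k where k: "continuous_map (top_of_set (?I \<times> ?I)) T k"
    "\<And>t. k (0, t) = p t" "\<And>t. k (1, t) = p' t" "\<And>s. s \<in> ?I \<Longrightarrow> k (s, 0) = a \<and> k (s, 1) = b"
    using p unfolding homotopic_with_def II by auto
  obtain l where l: "continuous_map (top_of_set (?I \<times> ?I)) T l"
    "\<And>t. l (0, t) = q t" "\<And>t. l (1, t) = q' t" "\<And>s. s \<in> ?I \<Longrightarrow> l (s, 0) = b \<and> l (s, 1) = c"
    using q unfolding homotopic_with_def II by auto
  let ?K = "\<lambda>z. if snd z \<le> 1/2 then k (fst z, 2 * snd z) else l (fst z, 2 * snd z - 1)"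
  have "continuous_map (top_of_set (?I \<times> ?I)) T ?K"
  proof (rule continuous_map_cases_le)
    let ?A = "(?I \<times> ?I) \<inter> {z \<in> ?I \<times> ?I. snd z \<le> 1/2}"
    have "continuous_map (top_of_set ?A) (top_of_set (?I \<times> ?I)) (\<lambda>z. (fst z, 2 * snd z))"
      by (auto intro!: continuous_intros)
    from continuous_map_compose[OF this k(1)]
    show "continuous_map (subtopology (top_of_set (?I \<times> ?I)) {z \<in> topspace (top_of_set (?I \<times> ?I)). snd z \<le> 1/2}) T
      (\<lambda>z. k (fst z, 2 * snd z))"
      by (simp add: subtopology_subtopology o_def)
    let ?B = "(?I \<times> ?I) \<inter> {z \<in> ?I \<times> ?I. 1/2 \<le> snd z}"
    have "continuous_map (top_of_set ?B) (top_of_set (?I \<times> ?I)) (\<lambda>z. (fst z, 2 * snd z - 1))"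
      by (auto intro!: continuous_intros)
    from continuous_map_compose[OF this l(1)]
    show "continuous_map (subtopology (top_of_set (?I \<times> ?I)) {z \<in> topspace (top_of_set (?I \<times> ?I)). 1/2 \<le> snd z}) T
      (\<lambda>z. l (fst z, 2 * snd z - 1))"
      by (simp add: subtopology_subtopology o_def)
    show "k (fst z, 2 * snd z) = l (fst z, 2 * snd z - 1)"
      if "z \<in> topspace (top_of_set (?I \<times> ?I))" "snd z = 1/2" for z
    proof -
      have "2 * snd z = 1" "fst z \<in> ?I" using that by auto
      then show ?thesis using k(4)[of "fst z"] l(4)[of "fst z"] by simp
    qed
  qed (auto intro!: continuous_intros)
  then show ?thesis
    unfolding homotopic_with_def II
    by (intro exI[of _ ?K]) (auto simp: path_join_def fun_eq_iff k l)
qed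

lemma pathin_path_join:
  assumes "pathin T p" and "pathin T q" and "p 1 = q 0"
  shows "pathin T (path_join p q)"
  using homotopic_with_imp_continuous_maps[OF homotopic_path_join[of "p 0" "p 1" T p p "q 1" q q]] assms
  by (simp add: pathin_def)

lemma pathin_path_reverse: "pathin T p \<Longrightarrow> pathin T (path_reverse p)"
  unfolding path_reverse_def by (rule pathin_reparam) (auto intro!: continuous_intros)

lemma path_join_ends [simp]: "path_join p q 0 = p 0" "path_join p q 1 = q 1"
  by (simp_all add: path_join_def)

lemma path_reverse_ends [simp]: "path_reverse p 0 = p 1" "path_reverse p 1 = p 0"
  by (simp_all add: path_reverse_def)

lemma lift_end_unique:
  assumes "covering_map E T q" and "pathin E g" and "pathin E g'"
    and "\<And>t. t \<in> {0..1} \<Longrightarrow> q (g t) = q (g' t)" and "g 0 = g' 0"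
  shows "g 1 = g' 1"
  using covering_lift_unique[OF assms(1), of 0 1 g g' 1] assms by (simp add: pathin_def)

lemma path_lift_exists:
  assumes "covering_map E T q" and "pathin T f" and "e \<in> topspace E" and "q e = f 0"
  obtains g where "pathin E g" and "g 0 = e" and "\<And>t. t \<in> {0..1} \<Longrightarrow> q (g t) = f t"
  using covering_lift_exists[OF assms(1), of 0 1 f e] assms(2-4) by (auto simp: pathin_def)

definition lifts_to_loop where
  "lifts_to_loop E q x w \<longleftrightarrow> (\<exists>g\<in>loops E x. \<forall>t\<in>{0..1}. q (g t) = w t)"

lemma lifts_to_loop_iff_end:
  assumes "covering_map E T q" and "pathin E g" and "g 0 = x" and "\<And>t. t \<in> {0..1} \<Longrightarrow> q (g t) = w t"
  shows "lifts_to_loop E q x w \<longleftrightarrow> g 1 = x"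
proof
  assume "lifts_to_loop E q x w"
  then obtain k where "pathin E k" "k 0 = x" "k 1 = x" "\<forall>t\<in>{0..1}. q (k t) = w t"
    by (auto simp: lifts_to_loop_def loops_def)
  then show "g 1 = x" using lift_end_unique[OF assms(1,2), of k] assms(3,4) by simp
next
  assume "g 1 = x"
  then show "lifts_to_loop E q x w" using assms by (auto simp: lifts_to_loop_def loops_def)
qed

lemma lifting_criterion:
  assumes cov: "covering_map E T q" and pc: "path_connected_space S"
    and lpc: "locally_path_connected_space S" and f: "continuous_map S T f"
    and x: "x \<in> topspace S" and y: "y \<in> topspace E" and qy: "q y = f x"
    and closed: "\<And>\<alpha>. \<alpha> \<in> loops S x \<Longrightarrow> lifts_to_loop E q y (\<lambda>t. f (\<alpha> t))"
  obtains H where "continuous_map S E H" and "H x = y" and "\<And>z. z \<in> topspace S \<Longrightarrow> q (H z) = f z"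
proof -
  define lifts where "lifts \<alpha> \<beta> \<longleftrightarrow> pathin S \<alpha> \<and> \<alpha> 0 = x \<and> pathin E \<beta> \<and> \<beta> 0 = y \<and>
     (\<forall>t\<in>{0..1}. q (\<beta> t) = f (\<alpha> t))" for \<alpha> \<beta> :: "real \<Rightarrow> _"
  have ex: "\<exists>\<alpha> \<beta>. lifts \<alpha> \<beta> \<and> \<alpha> 1 = z" if "z \<in> topspace S" for z
  proof -
    obtain \<alpha> where \<alpha>: "pathin S \<alpha>" "\<alpha> 0 = x" "\<alpha> 1 = z"
      using pc x \<open>z \<in> topspace S\<close> unfolding path_connected_space_def by meson
    have "pathin T (f \<circ> \<alpha>)" using pathin_compose[OF \<alpha>(1) f] .
    then obtain \<beta> where "pathin E \<beta>" "\<beta> 0 = y" "\<And>t. t \<in> {0..1} \<Longrightarrow> q (\<beta> t) = (f \<circ> \<alpha>) t"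
      using path_lift_exists[OF cov _ y, of "f \<circ> \<alpha>"] qy \<alpha>(2) by auto
    then have "lifts \<alpha> \<beta>" using \<alpha> by (simp add: lifts_def)
    then show ?thesis using \<alpha>(3) by blast
  qed
  have wd: "\<beta> 1 = \<beta>' 1" if L: "lifts \<alpha> \<beta>" "lifts \<alpha>' \<beta>'" "\<alpha> 1 = \<alpha>' 1" for \<alpha> \<beta> \<alpha>' \<beta>'
  proof -
    let ?l = "path_join \<alpha> (path_reverse \<alpha>')"
    have "?l \<in> loops S x"
      using L pathin_path_join[OF _ pathin_path_reverse, of S \<alpha> \<alpha>'] by (simp add: loops_def lifts_def)
    then obtain \<delta> where \<delta>: "pathin E \<delta>" "\<delta> 0 = y" "\<delta> 1 = y" "\<And>t. t \<in> {0..1} \<Longrightarrow> q (\<delta> t) = f (?l t)"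
      using closed[of ?l] by (auto simp: lifts_to_loop_def loops_def)
    have "(\<lambda>t. \<delta> (t / 2)) 1 = \<beta> 1"
    proof (rule lift_end_unique[OF cov, of "\<lambda>t. \<delta> (t / 2)"])
      show "pathin E (\<lambda>t. \<delta> (t / 2))"
        by (rule pathin_reparam[OF \<delta>(1)]) (auto intro!: continuous_intros)
    qed (use L \<delta> in \<open>auto simp: lifts_def path_join_def\<close>)
    moreover have "(\<lambda>t. \<delta> (1 - t / 2)) 1 = \<beta>' 1"
    proof (rule lift_end_unique[OF cov, of "\<lambda>t. \<delta> (1 - t / 2)"])
      show "pathin E (\<lambda>t. \<delta> (1 - t / 2))"
        by (rule pathin_reparam[OF \<delta>(1)]) (auto intro!: continuous_intros)
      show "q (\<delta> (1 - t / 2)) = q (\<beta>' t)" if "t \<in> {0..1}" for t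
      proof -
        have "?l (1 - t / 2) = \<alpha>' t"
          using that L(3) by (cases "t = 1") (auto simp: path_join_def path_reverse_def)
        then show ?thesis using \<delta>(4)[of "1 - t / 2"] L that by (simp add: lifts_def)
      qed
    qed (use L \<delta> in \<open>auto simp: lifts_def\<close>)
    ultimately show ?thesis by simp
  qed
  define H where "H z = (SOME e. \<exists>\<alpha> \<beta>. lifts \<alpha> \<beta> \<and> \<alpha> 1 = z \<and> \<beta> 1 = e)" for z
  have H: "H (\<alpha> 1) = \<beta> 1" if "lifts \<alpha> \<beta>" for \<alpha> \<beta>
    unfolding H_def by (rule some_equality) (use that wd in metis)+
  have qH: "q (H z) = f z" if "z \<in> topspace S" for z
    using ex[OF that] H by (metis atLeastAtMost_iff lifts_def order_refl zero_le_one)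
  have HE: "H z \<in> topspace E" if "z \<in> topspace S" for z
    using ex[OF that] H path_finish_in_topspace lifts_def by metis
  have local: "\<exists>N. openin S N \<and> z \<in> N \<and> (\<forall>z'\<in>N. H z' \<in> W)"
    if z: "z \<in> topspace S" and W: "openin E W" "H z \<in> W" for z W
  proof -
    have "f z \<in> topspace T" using z f by (auto simp: continuous_map_def Pi_iff)
    then obtain U V r where U: "openin T U" "f z \<in> U" and V: "H z \<in> V" "sheet_over E T q U V r"
      using evenly_covered_nhd[OF cov] HE[OF z] qH[OF z] by metis
    have "openin T {y \<in> U. r y \<in> W}" using sheet_over_openin[OF V(2) U(1)] W by blast
    then have "openin S {z \<in> topspace S. f z \<in> {y \<in> U. r y \<in> W}}"
      by (rule openin_continuous_map_preimage[OF f])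
    moreover have rf: "r (f z) = H z" using sheet_overD(6)[OF V(2,1)] qH[OF z] by simp
    ultimately obtain N where N: "openin S N" "path_connectedin S N" "z \<in> N"
      "N \<subseteq> {z \<in> topspace S. f z \<in> {y \<in> U. r y \<in> W}}"
      using lpc[unfolded locally_path_connected_space, rule_format,
          of "{z \<in> topspace S. f z \<in> {y \<in> U. r y \<in> W}}" z] z U(2) W(2) by auto
    have NU: "f y \<in> U" if "y \<in> N" for y using N(4) that by auto
    have "H z' \<in> W" if z': "z' \<in> N" for z'
    proof -
      obtain \<kappa> where \<kappa>: "pathin S \<kappa>" "\<And>t. t \<in> {0..1} \<Longrightarrow> \<kappa> t \<in> N" "\<kappa> 0 = z" "\<kappa> 1 = z'"
        using N(2,3) z' unfolding path_connectedin by blast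
      obtain \<alpha> \<beta> where L: "lifts \<alpha> \<beta>" "\<alpha> 1 = z" using ex[OF z] by blast
      have fk: "pathin (subtopology T U) (f \<circ> \<kappa>)"
        using pathin_compose[OF \<kappa>(1) f] NU[OF \<kappa>(2)] by (simp add: pathin_subtopology)
      have rfk: "pathin E (r \<circ> (f \<circ> \<kappa>))" by (rule pathin_compose[OF fk sheet_overD(2)[OF V(2)]])
      have "\<beta> 1 = H z" using H[OF L(1)] L(2) by simp
      then have "pathin E (path_join \<beta> (r \<circ> (f \<circ> \<kappa>)))"
        using L rfk rf \<kappa>(3) by (intro pathin_path_join) (auto simp: lifts_def)
      moreover have "pathin S (path_join \<alpha> \<kappa>)"
        using L \<kappa> by (intro pathin_path_join) (auto simp: lifts_def)
      moreover have "q (r (f (\<kappa> t))) = f (\<kappa> t)" if "t \<in> {0..1}" for t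
        by (rule sheet_overD(4)[OF V(2) NU[OF \<kappa>(2)[OF that]]])
      ultimately have "lifts (path_join \<alpha> \<kappa>) (path_join \<beta> (r \<circ> (f \<circ> \<kappa>)))"
        using L(1) by (auto simp: lifts_def path_join_def)
      from H[OF this] have "H z' = r (f z')" using \<kappa>(4) by simp
      then show ?thesis using z' N(4) by auto
    qed
    then show ?thesis using N(1,3) by blast
  qed
  have "continuous_map S E H"
    unfolding continuous_map
  proof (intro conjI allI impI)
    show "H ` topspace S \<subseteq> topspace E" using HE by auto
    fix W assume "openin E W"
    show "openin S {z \<in> topspace S. H z \<in> W}"
    proof (subst openin_subopen, intro ballI)
      fix z assume "z \<in> {z \<in> topspace S. H z \<in> W}"
      then obtain N where "openin S N" "z \<in> N" "\<forall>z'\<in>N. H z' \<in> W"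
        using local \<open>openin E W\<close> by blast
      then show "\<exists>N. openin S N \<and> z \<in> N \<and> N \<subseteq> {z \<in> topspace S. H z \<in> W}"
        using openin_subset by blast
    qed
  qed
  moreover have "H x = y"
    using H[of "\<lambda>_. x" "\<lambda>_. y"] x y qy by (simp add: lifts_def)
  ultimately show thesis using that qH by blast
qed

lemma covering_space_locally_path_connected:
  assumes cov: "covering_map E T q" and lpc: "locally_path_connected_space T"
  shows "locally_path_connected_space E"
  unfolding locally_path_connected_space
proof (intro allI impI, elim conjE)
  fix W e assume W: "openin E W" "e \<in> W"
  then have e: "e \<in> topspace E" using openin_subset by blast
  have q: "continuous_map E T q" by (rule covering_map_imp_continuous[OF cov])
  then have "q e \<in> topspace T" using e by (auto simp: continuous_map_def Pi_iff)
  then obtain U V r where U: "openin T U" "q e \<in> U" and V: "e \<in> V" "sheet_over E T q U V r"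
    using evenly_covered_nhd[OF cov] e by metis
  have "openin T {y \<in> U. r y \<in> W}" using sheet_over_openin[OF V(2) U(1)] W by blast
  moreover have "r (q e) = e" by (rule sheet_overD(6)[OF V(2,1)])
  ultimately obtain N where N: "openin T N" "path_connectedin T N" "q e \<in> N" "N \<subseteq> {y \<in> U. r y \<in> W}"
    using lpc[unfolded locally_path_connected_space, rule_format, of "{y \<in> U. r y \<in> W}" "q e"] U(2) W(2)
    by auto
  have "path_connectedin (subtopology T U) N"
    using N(2,4) by (auto simp: path_connectedin_subtopology)
  then have "path_connectedin E (r ` N)"
    by (rule path_connectedin_continuous_map_image[OF sheet_overD(2)[OF V(2)]])
  moreover have "r ` N = V \<inter> {z \<in> topspace E. q z \<in> N}"
    using N(4) sheet_overD(3,4,6)[OF V(2)] openin_subset[OF sheet_overD(1)[OF V(2)]]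
    by (force simp: image_iff)
  then have "openin E (r ` N)"
    using sheet_overD(1)[OF V(2)] openin_continuous_map_preimage[OF q N(1)] by (simp add: openin_Int)
  ultimately show "\<exists>N. openin E N \<and> path_connectedin E N \<and> e \<in> N \<and> N \<subseteq> W"
    using N(3,4) \<open>r (q e) = e\<close> by (intro exI[of _ "r ` N"]) force
qed

lemma covering_homeomorphism:
  assumes p: "covering_map E1 T1 p" and q: "covering_map E2 T2 q" and h: "homeomorphic_maps T1 T2 h k"
    and lpc: "locally_path_connected_space T1" "locally_path_connected_space T2"
    and conn: "connected_space E1" "connected_space E2"
    and x1: "x1 \<in> topspace E1" and x2: "x2 \<in> topspace E2" and qx2: "q x2 = h (p x1)"
    and l1: "\<And>\<alpha>. \<alpha> \<in> loops E1 x1 \<Longrightarrow> lifts_to_loop E2 q x2 (\<lambda>t. h (p (\<alpha> t)))"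
    and l2: "\<And>\<beta>. \<beta> \<in> loops E2 x2 \<Longrightarrow> lifts_to_loop E1 p x1 (\<lambda>t. k (q (\<beta> t)))"
  obtains H where "homeomorphic_map E1 E2 H" and "\<And>z. z \<in> topspace E1 \<Longrightarrow> q (H z) = h (p z)"
proof -
  note pq = covering_map_imp_continuous[OF p] covering_map_imp_continuous[OF q]
  have hk: "continuous_map T1 T2 h" "continuous_map T2 T1 k"
    "\<And>y. y \<in> topspace T1 \<Longrightarrow> k (h y) = y" "\<And>y. y \<in> topspace T2 \<Longrightarrow> h (k y) = y"
    using h by (auto simp: homeomorphic_maps_def)
  have pT: "p z \<in> topspace T1" if "z \<in> topspace E1" for z
    using pq(1) that by (auto simp: continuous_map_def Pi_iff)
  have qT: "q z \<in> topspace T2" if "z \<in> topspace E2" for z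
    using pq(2) that by (auto simp: continuous_map_def Pi_iff)
  note lE = covering_space_locally_path_connected[OF p lpc(1)] covering_space_locally_path_connected[OF q lpc(2)]
  have pc: "path_connected_space E1" "path_connected_space E2"
    using lE conn path_connected_eq_connected_space by blast+
  obtain H where H: "continuous_map E1 E2 H" "H x1 = x2" "\<And>z. z \<in> topspace E1 \<Longrightarrow> q (H z) = (h \<circ> p) z"
    using lifting_criterion[OF q pc(1) lE(1) continuous_map_compose[OF pq(1) hk(1)] x1 x2] qx2 l1
    by auto
  obtain H' where H': "continuous_map E2 E1 H'" "H' x2 = x1" "\<And>z. z \<in> topspace E2 \<Longrightarrow> p (H' z) = (k \<circ> q) z"
    using lifting_criterion[OF p pc(2) lE(2) continuous_map_compose[OF pq(2) hk(2)] x2 x1] qx2 l2 hk(3) pT[OF x1]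
    by auto
  have HE: "H z \<in> topspace E2" if "z \<in> topspace E1" for z
    using H(1) that by (auto simp: continuous_map_def Pi_iff)
  have HE': "H' z \<in> topspace E1" if "z \<in> topspace E2" for z
    using H'(1) that by (auto simp: continuous_map_def Pi_iff)
  have "H' (H z) = z" if z: "z \<in> topspace E1" for z
  proof -
    obtain \<alpha> where \<alpha>: "pathin E1 \<alpha>" "\<alpha> 0 = x1" "\<alpha> 1 = z"
      using pc x1 z unfolding path_connected_space_def by meson
    have "\<alpha> t \<in> topspace E1" if "t \<in> {0..1}" for t
      using path_image_subset_topspace[OF \<alpha>(1)] that by auto
    then have "(H' \<circ> (H \<circ> \<alpha>)) 1 = \<alpha> 1"
      using \<alpha>(1,2) H H' HE hk(3) pT
      by (intro lift_end_unique[OF p pathin_compose[OF pathin_compose[OF \<alpha>(1) H(1)] H'(1)] \<alpha>(1)]) auto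
    then show ?thesis using \<alpha>(3) by simp
  qed
  moreover have "H (H' z) = z" if z: "z \<in> topspace E2" for z
  proof -
    obtain \<alpha> where \<alpha>: "pathin E2 \<alpha>" "\<alpha> 0 = x2" "\<alpha> 1 = z"
      using pc x2 z unfolding path_connected_space_def by meson
    have "\<alpha> t \<in> topspace E2" if "t \<in> {0..1}" for t
      using path_image_subset_topspace[OF \<alpha>(1)] that by auto
    then have "(H \<circ> (H' \<circ> \<alpha>)) 1 = \<alpha> 1"
      using \<alpha>(1,2) H H' HE' hk(4) qT
      by (intro lift_end_unique[OF q pathin_compose[OF pathin_compose[OF \<alpha>(1) H'(1)] H(1)] \<alpha>(1)]) auto
    then show ?thesis using \<alpha>(3) by simp
  qed
  ultimately have "homeomorphic_maps E1 E2 H H'"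
    using H H' by (simp add: homeomorphic_maps_def)
  then show thesis using that H(3) homeomorphic_maps_imp_map by force
qed

section \<open>Fundamental groups and closed lifts\<close>

lemma loop_homotopic_refl: "p \<in> loops T b \<Longrightarrow> loop_homotopic T b p p"
  by (simp add: loop_homotopic_def loops_def pathin_def)

lemma loop_class_eqI:
  assumes "loop_homotopic T b p q"
  shows "loop_class T b p = loop_class T b q"
  using assms unfolding loop_class_def loop_homotopic_def
  by (auto intro: homotopic_with_trans homotopic_with_symD)

lemma induced_map_loop_class:
  assumes f: "continuous_map S T f" and \<gamma>: "pathin T \<gamma>" "\<gamma> 0 = b" "\<gamma> 1 = f a" and l: "w \<in> loops S a"
  shows "induced_map T b \<gamma> f (loop_class S a w) =
    loop_class T b (path_join \<gamma> (path_join (f \<circ> w) (path_reverse \<gamma>)))"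
proof -
  have "loop_homotopic T b (path_join \<gamma> (path_join (f \<circ> w) (path_reverse \<gamma>)))
      (path_join \<gamma> (path_join (f \<circ> p) (path_reverse \<gamma>)))" if "loop_homotopic S a w p" for p
    unfolding loop_homotopic_def
  proof (intro homotopic_path_join)
    show "homotopic_with (\<lambda>r. r 0 = b \<and> r 1 = f a) (top_of_set {0..1}) T \<gamma> \<gamma>"
      using \<gamma> by (simp add: pathin_def)
    show "homotopic_with (\<lambda>r. r 0 = f a \<and> r 1 = b) (top_of_set {0..1}) T (path_reverse \<gamma>) (path_reverse \<gamma>)"
      using \<gamma> pathin_path_reverse[OF \<gamma>(1)] by (simp add: pathin_def)
    show "homotopic_with (\<lambda>r. r 0 = f a \<and> r 1 = f a) (top_of_set {0..1}) T (f \<circ> w) (f \<circ> p)"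
      using that unfolding loop_homotopic_def
      by (rule homotopic_with_compose_continuous_map_left[OF _ f]) auto
  qed
  then have eq: "loop_class T b (path_join \<gamma> (path_join (f \<circ> p) (path_reverse \<gamma>))) =
      loop_class T b (path_join \<gamma> (path_join (f \<circ> w) (path_reverse \<gamma>)))" if "p \<in> loop_class S a w" for p
    using that loop_class_eqI[of T b] by (auto simp: loop_class_def[of S])
  have "w \<in> loop_class S a w" using loop_homotopic_refl[OF l] by (simp add: loop_class_def)
  then have "(\<Union>p\<in>loop_class S a w. loop_class T b (path_join \<gamma> (path_join (f \<circ> p) (path_reverse \<gamma>)))) =
      loop_class T b (path_join \<gamma> (path_join (f \<circ> w) (path_reverse \<gamma>)))"
    by (intro SUP_eq_const eq) blast
  moreover have "induced_map T b \<gamma> f (loop_class S a w) =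
      (\<Union>p\<in>loop_class S a w. loop_class T b (path_join \<gamma> (path_join (f \<circ> p) (path_reverse \<gamma>))))"
    by (auto simp: induced_map_def loop_class_def[of T])
  ultimately show ?thesis by (rule trans[rotated])
qed

text \<open>
  With a constant path \<open>\<gamma>\<close>, \<open>induced_map\<close> still pads the loop with constant pieces; the padded loop is
  the reparametrisation of the loop by \<open>\<rho>\<close>.
\<close>

lemma induced_map_const_loop_class:
  assumes q: "continuous_map E T q" and g: "g \<in> loops E x" and b: "q x = b"
    and qg: "\<And>t. t \<in> {0..1} \<Longrightarrow> q (g t) = w t"
  shows "induced_map T b (\<lambda>_. b) q (loop_class E x g) = loop_class T b w"
proof -
  define \<rho> :: "real \<Rightarrow> real" where "\<rho> t = max 0 (min 1 (4 * t - 2))" for t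
  have l: "pathin T w" "w 0 = b" "w 1 = b"
  proof -
    have "pathin T (q \<circ> g)" using g q by (auto simp: loops_def intro: pathin_compose)
    then show "pathin T w"
      unfolding pathin_def using qg by (auto elim!: continuous_map_eq)
    show "w 0 = b" "w 1 = b" using qg[of 0] qg[of 1] g b by (auto simp: loops_def)
  qed
  have bT: "b \<in> topspace T" using path_start_in_topspace[OF l(1)] l(2) by simp
  have "induced_map T b (\<lambda>_. b) q (loop_class E x g) =
      loop_class T b (path_join (\<lambda>_. b) (path_join (q \<circ> g) (path_reverse (\<lambda>_. b))))"
    by (rule induced_map_loop_class[OF q _ _ _ g]) (use bT b in simp_all)
  also have "path_join (\<lambda>_. b) (path_join (q \<circ> g) (path_reverse (\<lambda>_. b))) = (\<lambda>t. w (\<rho> t))"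
  proof
    fix t :: real
    consider "t \<le> 1/2" | "1/2 < t" "t \<le> 3/4" | "3/4 < t" by linarith
    then show "path_join (\<lambda>_. b) (path_join (q \<circ> g) (path_reverse (\<lambda>_. b))) t = w (\<rho> t)"
    proof cases
      case 2
      then have "\<rho> t = 2 * (2 * t - 1)" by (simp add: \<rho>_def)
      then show ?thesis using 2 qg[of "\<rho> t"] by (simp add: path_join_def)
    qed (use l in \<open>simp_all add: path_join_def path_reverse_def \<rho>_def\<close>)
  qed
  also have "loop_class T b (\<lambda>t. w (\<rho> t)) = loop_class T b w"
  proof (rule loop_class_eqI)
    let ?I = "{0..1::real}"
    let ?\<mu> = "\<lambda>z. (1 - fst z) * \<rho> (snd z) + fst z * snd z"
    have \<rho>: "0 \<le> \<rho> t" "\<rho> t \<le> 1" for t by (auto simp: \<rho>_def)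
    have "?\<mu> z \<in> ?I" if "z \<in> ?I \<times> ?I" for z
    proof -
      have "0 \<le> ?\<mu> z" using that \<rho> by (auto intro!: add_nonneg_nonneg mult_nonneg_nonneg)
      moreover have "(1 - fst z) * \<rho> (snd z) \<le> 1 - fst z" "fst z * snd z \<le> fst z"
        using that \<rho> by (auto intro!: mult_left_le)
      ultimately show ?thesis by auto
    qed
    moreover have "continuous_on (?I \<times> ?I) ?\<mu>"
      unfolding \<rho>_def by (intro continuous_intros)
    ultimately have "continuous_map (top_of_set (?I \<times> ?I)) (top_of_set ?I) ?\<mu>"
      by auto
    then have "continuous_map (top_of_set (?I \<times> ?I)) T (w \<circ> ?\<mu>)"
      using l(1) unfolding pathin_def by (rule continuous_map_compose)
    then have "continuous_map (prod_topology (top_of_set ?I) (top_of_set ?I)) T (w \<circ> ?\<mu>)"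
      by (simp add: prod_topology_subtopology subtopology_subtopology Times_Int_Times)
    moreover have "\<rho> 0 = 0" "\<rho> 1 = 1" by (simp_all add: \<rho>_def)
    ultimately show "loop_homotopic T b (\<lambda>t. w (\<rho> t)) w"
      unfolding loop_homotopic_def homotopic_with_def
      by (intro exI[of _ "w \<circ> ?\<mu>"]) (auto simp: l)
  qed
  finally show ?thesis .
qed

lemma lifts_to_loop_iff_kernel:
  assumes cov: "covering_map E T q" and x: "x \<in> topspace E" "q x = b"
    and img: "induced_map T b (\<lambda>_. b) q ` carrier (fundamental_group E x) =
      kernel (fundamental_group T b) G \<theta>"
    and l: "w \<in> loops T b"
  shows "lifts_to_loop E q x w \<longleftrightarrow> \<theta> (loop_class T b w) = \<one>\<^bsub>G\<^esub>"
proof -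
  note q = covering_map_imp_continuous[OF cov]
  have lc: "loop_class T b w \<in> carrier (fundamental_group T b)"
    using l by (simp add: fundamental_group_def)
  have "lifts_to_loop E q x w \<longleftrightarrow>
    loop_class T b w \<in> induced_map T b (\<lambda>_. b) q ` carrier (fundamental_group E x)"
  proof
    assume "lifts_to_loop E q x w"
    then obtain g where g: "g \<in> loops E x" "\<forall>t\<in>{0..1}. q (g t) = w t"
      by (auto simp: lifts_to_loop_def)
    then have "induced_map T b (\<lambda>_. b) q (loop_class E x g) = loop_class T b w"
      using induced_map_const_loop_class[OF q g(1) x(2)] by blast
    then show "loop_class T b w \<in> induced_map T b (\<lambda>_. b) q ` carrier (fundamental_group E x)"
      using g(1) by (force simp: fundamental_group_def)
  next
    assume "loop_class T b w \<in> induced_map T b (\<lambda>_. b) q ` carrier (fundamental_group E x)"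
    then obtain d where d: "d \<in> loops E x" "loop_class T b w = induced_map T b (\<lambda>_. b) q (loop_class E x d)"
      by (auto simp: fundamental_group_def)
    have "induced_map T b (\<lambda>_. b) q (loop_class E x d) = loop_class T b (q \<circ> d)"
      using induced_map_const_loop_class[OF q d(1) x(2), of "q \<circ> d"] by simp
    then have hom: "loop_homotopic T b (q \<circ> d) w"
      using d(2) loop_homotopic_refl[OF l] by (auto simp: loop_class_def)
    obtain g where g: "pathin E g" "g 0 = x" "\<And>t. t \<in> {0..1} \<Longrightarrow> q (g t) = w t"
      using path_lift_exists[OF cov _ x(1), of w] l x(2) by (auto simp: loops_def)
    have "d 1 = g 1"
      by (rule homotopic_loops_lift_endpoint[OF cov hom]) (use d(1) g in \<open>auto simp: loops_def\<close>)
    then show "lifts_to_loop E q x w"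
      using lifts_to_loop_iff_end[OF cov g] d(1) by (simp add: loops_def)
  qed
  then show ?thesis using img lc by (auto simp: kernel_def)
qed

lemma lifts_to_loop_conjugate:
  assumes cov: "covering_map E T q" and c: "pathin E c" "\<And>t. t \<in> {0..1} \<Longrightarrow> q (c t) = \<gamma> t"
    and l: "w 0 = \<gamma> 1" "w 1 = \<gamma> 1"
  shows "lifts_to_loop E q (c 0) (path_join \<gamma> (path_join w (path_reverse \<gamma>))) \<longleftrightarrow>
    lifts_to_loop E q (c 1) w" (is "?L \<longleftrightarrow> ?R")
proof
  let ?m = "path_join \<gamma> (path_join w (path_reverse \<gamma>))"
  assume ?R
  then obtain g where g: "pathin E g" "g 0 = c 1" "g 1 = c 1" "\<forall>t\<in>{0..1}. q (g t) = w t"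
    by (auto simp: lifts_to_loop_def loops_def)
  have "pathin E (path_join c (path_join g (path_reverse c)))"
    using c g by (intro pathin_path_join pathin_path_reverse) auto
  moreover have "q (path_join c (path_join g (path_reverse c)) t) = ?m t" if "t \<in> {0..1}" for t
    using that c(2) g(4) by (auto simp: path_join_def path_reverse_def)
  ultimately show ?L
    by (auto simp: lifts_to_loop_def loops_def intro!: bexI[of _ "path_join c (path_join g (path_reverse c))"])
next
  let ?m = "path_join \<gamma> (path_join w (path_reverse \<gamma>))"
  assume ?L
  then obtain d where d: "pathin E d" "d 0 = c 0" "d 1 = c 0" "\<And>t. t \<in> {0..1} \<Longrightarrow> q (d t) = ?m t"
    by (auto simp: lifts_to_loop_def loops_def)
  have "(\<lambda>t. d (t / 2)) 1 = c 1"
  proof (rule lift_end_unique[OF cov _ c(1), of "\<lambda>t. d (t / 2)"])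
    show "pathin E (\<lambda>t. d (t / 2))"
      by (rule pathin_reparam[OF d(1)]) (auto intro!: continuous_intros)
  qed (use d c(2) in \<open>auto simp: path_join_def\<close>)
  moreover have "(\<lambda>t. d (1 - t / 4)) 1 = c 1"
  proof (rule lift_end_unique[OF cov _ c(1), of "\<lambda>t. d (1 - t / 4)"])
    show "pathin E (\<lambda>t. d (1 - t / 4))"
      by (rule pathin_reparam[OF d(1)]) (auto intro!: continuous_intros)
    show "q (d (1 - t / 4)) = q (c t)" if "t \<in> {0..1}" for t
    proof -
      have "?m (1 - t / 4) = \<gamma> t"
        using that l by (cases "t = 1") (auto simp: path_join_def path_reverse_def)
      then show ?thesis using d(4)[of "1 - t / 4"] c(2)[OF that] that by simp
    qed
  qed (use d in auto)
  moreover have "pathin E (\<lambda>t. d (1/2 + t / 4))"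
    by (rule pathin_reparam[OF d(1)]) (auto intro!: continuous_intros)
  moreover have "q (d (1/2 + t / 4)) = w t" if "t \<in> {0..1}" for t
  proof -
    have "?m (1/2 + t / 4) = w t"
      using that l by (cases "t = 0") (auto simp: path_join_def path_reverse_def)
    then show ?thesis using d(4)[of "1/2 + t / 4"] that by simp
  qed
  ultimately show ?R
    by (auto simp: lifts_to_loop_def loops_def intro!: bexI[of _ "\<lambda>t. d (1/2 + t / 4)"])
qed

section \<open>Local path-connectedness of smooth loci\<close>

definition l1 :: "nat \<Rightarrow> (nat \<Rightarrow> complex) \<Rightarrow> real" where
  "l1 c u = (\<Sum>j<c. norm (u j))"

lemma l1_nonneg: "0 \<le> l1 c u"
  by (simp add: l1_def sum_nonneg)

lemma norm_le_l1: "j < c \<Longrightarrow> norm (u j) \<le> l1 c u"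
  unfolding l1_def by (rule member_le_sum) auto

lemma l1_le_0D:
  assumes "l1 c u \<le> 0" and "j < c"
  shows "u j = 0"
  using order_trans[OF norm_le_l1[OF assms(2)] assms(1)] by simp

lemma l1_triangle: "l1 c (\<lambda>j. u j + v j) \<le> l1 c u + l1 c v"
  unfolding l1_def by (simp add: norm_triangle_ineq sum_mono flip: sum.distrib)

definition l1_cball :: "nat \<Rightarrow> real \<Rightarrow> (nat \<Rightarrow> complex) set" where
  "l1_cball c \<eta> = {u. l1 c u \<le> \<eta> \<and> (\<forall>j\<ge>c. u j = 0)}"

lemma compact_l1_cball: "compact (l1_cball c \<eta>)"
proof -
  have "compact (Pi UNIV (\<lambda>_::nat. cball (0::complex) \<eta>))"
    using compactin_PiE[of "\<lambda>_. euclidean" UNIV "\<lambda>_::nat. cball (0::complex) \<eta>"]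
    by (simp add: euclidean_product_topology PiE_UNIV_domain)
  moreover have "closed (l1_cball c \<eta>)"
  proof -
    have "closed {u. l1 c u \<le> \<eta>}"
      unfolding l1_def by (intro closed_Collect_le continuous_intros continuous_on_product_coordinates)
    moreover have "closed {u::nat \<Rightarrow> complex. \<forall>j\<in>{c..}. u j = 0}"
      unfolding Ball_def
      by (intro closed_Collect_all closed_Collect_imp closed_Collect_eq continuous_on_const
          continuous_on_product_coordinates) auto
    moreover have "l1_cball c \<eta> = {u. l1 c u \<le> \<eta>} \<inter> {u. \<forall>j\<in>{c..}. u j = 0}"
      by (auto simp: l1_cball_def)
    ultimately show ?thesis by (simp add: closed_Int)
  qed
  moreover have "l1_cball c \<eta> \<subseteq> Pi UNIV (\<lambda>_. cball 0 \<eta>)"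
  proof
    fix u assume u: "u \<in> l1_cball c \<eta>"
    then have "0 \<le> \<eta>" using l1_nonneg[of c u] by (simp add: l1_cball_def)
    then have "norm (u j) \<le> \<eta>" for j
      using u norm_le_l1[of j c u] by (cases "j < c") (auto simp: l1_cball_def)
    then show "u \<in> Pi UNIV (\<lambda>_. cball 0 \<eta>)" by simp
  qed
  ultimately show ?thesis by (metis closed_Int_compact inf.absorb1)
qed

lemma l1_cball_eqI:
  assumes "u \<in> l1_cball c \<eta>" and "v \<in> l1_cball c \<eta>" and "l1 c (\<lambda>j. u j - v j) \<le> 0"
  shows "u = v"
proof
  fix j
  show "u j = v j"
  proof (cases "j < c")
    case True
    then show ?thesis using l1_le_0D[OF assms(3)] by simp
  qed (use assms(1,2) in \<open>simp add: l1_cball_def\<close>)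
qed

lemma parametrized_zero:
  fixes F :: "real \<Rightarrow> (nat \<Rightarrow> complex) \<Rightarrow> nat \<Rightarrow> complex"
  assumes \<eta>: "0 \<le> \<eta>"
    and cont_u: "\<And>t j. t \<in> {0..1} \<Longrightarrow> j < c \<Longrightarrow> continuous_on UNIV (\<lambda>u. F t u j)"
    and cont_t: "\<And>u j. u \<in> l1_cball c \<eta> \<Longrightarrow> j < c \<Longrightarrow> continuous_on {0..1} (\<lambda>t. F t u j)"
    and contr: "\<And>t u v. t \<in> {0..1} \<Longrightarrow> u \<in> l1_cball c \<eta> \<Longrightarrow> v \<in> l1_cball c \<eta> \<Longrightarrow>
      l1 c (\<lambda>j. (u j - F t u j) - (v j - F t v j)) \<le> l1 c (\<lambda>j. u j - v j) / 2"
    and small: "\<And>t. t \<in> {0..1} \<Longrightarrow> l1 c (F t (\<lambda>_. 0)) \<le> \<eta> / 2"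
  shows "\<exists>U. (\<forall>j. continuous_on {0..1} (\<lambda>t. U t j)) \<and>
    (\<forall>t\<in>{0..1}. U t \<in> l1_cball c \<eta> \<and> (\<forall>j<c. F t (U t) j = 0) \<and>
      (\<forall>u\<in>l1_cball c \<eta>. (\<forall>j<c. F t u j = 0) \<longrightarrow> U t = u))"
proof -
  let ?D = "l1_cball c \<eta>"
  have z: "(\<lambda>_. 0) \<in> ?D" using \<eta> by (simp add: l1_cball_def l1_def)
  have "\<exists>u\<in>?D. \<forall>j<c. F t u j = 0" if t: "t \<in> {0..1}" for t
  proof -
    have "continuous_on ?D (\<lambda>u. l1 c (F t u))"
      unfolding l1_def by (intro continuous_intros continuous_on_subset[OF cont_u[OF t]]) auto
    then obtain u where u: "u \<in> ?D" and min: "\<And>v. v \<in> ?D \<Longrightarrow> l1 c (F t u) \<le> l1 c (F t v)"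
      using continuous_attains_inf[OF compact_l1_cball, of c \<eta> "\<lambda>u. l1 c (F t u)"] z by blast
    \<comment> \<open>One step of the contraction \<open>u \<mapsto> u - F t u\<close> halves the residual, so at a minimum it is \<open>0\<close>.\<close>
    define v where "v j = (if j < c then u j - F t u j else 0)" for j
    have "l1 c v = l1 c (\<lambda>j. ((u j - F t u j) - (0 - F t (\<lambda>_. 0) j)) + (- F t (\<lambda>_. 0) j))"
      by (simp add: l1_def v_def)
    also have "\<dots> \<le> l1 c (\<lambda>j. (u j - F t u j) - (0 - F t (\<lambda>_. 0) j)) + l1 c (\<lambda>j. - F t (\<lambda>_. 0) j)"
      by (rule l1_triangle)
    also have "\<dots> \<le> l1 c u / 2 + \<eta> / 2"
      using contr[OF t u z] small[OF t] by (simp add: l1_def)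
    also have "\<dots> \<le> \<eta>" using u by (simp add: l1_cball_def)
    finally have v: "v \<in> ?D" by (simp add: l1_cball_def v_def)
    have "l1 c (F t v) = l1 c (\<lambda>j. (v j - F t v j) - (u j - F t u j))"
      by (simp add: l1_def v_def norm_minus_commute)
    also have "\<dots> \<le> l1 c (\<lambda>j. v j - u j) / 2" by (rule contr[OF t v u])
    also have "\<dots> = l1 c (F t u) / 2" by (simp add: l1_def v_def)
    finally have "l1 c (F t u) \<le> 0" using min[OF v] by simp
    then have "\<forall>j<c. F t u j = 0" using l1_le_0D by blast
    then show ?thesis using u by blast
  qed
  then obtain U where U: "\<And>t. t \<in> {0..1} \<Longrightarrow> U t \<in> ?D" "\<And>t j. t \<in> {0..1} \<Longrightarrow> j < c \<Longrightarrow> F t (U t) j = 0"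
    by metis
  have near: "l1 c (\<lambda>j. U t j - U s j) \<le> 2 * l1 c (\<lambda>j. F t (U s) j)" if "t \<in> {0..1}" "s \<in> {0..1}" for s t
  proof -
    have "l1 c (\<lambda>j. U t j - U s j) =
        l1 c (\<lambda>j. ((U t j - F t (U t) j) - (U s j - F t (U s) j)) + (- F t (U s) j))"
      using U(2)[OF that(1)] by (simp add: l1_def)
    also have "\<dots> \<le> l1 c (\<lambda>j. (U t j - F t (U t) j) - (U s j - F t (U s) j)) + l1 c (\<lambda>j. - F t (U s) j)"
      by (rule l1_triangle)
    also have "\<dots> \<le> l1 c (\<lambda>j. U t j - U s j) / 2 + l1 c (\<lambda>j. F t (U s) j)"
      using contr[OF that(1) U(1)[OF that(1)] U(1)[OF that(2)]] by (simp add: l1_def)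
    finally show ?thesis by simp
  qed
  have "continuous_on {0..1} (\<lambda>t. U t j)" for j
  proof (cases "j < c")
    case False
    then have "U t j = 0" if "t \<in> {0..1}" for t using U(1)[OF that] by (simp add: l1_cball_def)
    then show ?thesis using continuous_on_cong[of "{0..1}" "{0..1}" "\<lambda>t. U t j" "\<lambda>_. 0"] by simp
  next
    case True
    show ?thesis
      unfolding continuous_on_def
    proof
      fix s :: real assume s: "s \<in> {0..1}"
      have "continuous_on {0..1} (\<lambda>t. 2 * l1 c (F t (U s)))"
        unfolding l1_def by (intro continuous_intros cont_t U(1)[OF s]) auto
      moreover have "l1 c (F s (U s)) = 0" using U(2)[OF s] by (simp add: l1_def)
      ultimately have "((\<lambda>t. 2 * l1 c (F t (U s))) \<longlongrightarrow> 0) (at s within {0..1})"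
        using s unfolding continuous_on_def by (metis mult_zero_right)
      then have "((\<lambda>t. U t j - U s j) \<longlongrightarrow> 0) (at s within {0..1})"
      proof (rule Lim_null_comparison[rotated])
        show "\<forall>\<^sub>F t in at s within {0..1}. norm (U t j - U s j) \<le> 2 * l1 c (F t (U s))"
          unfolding eventually_at_filter
        proof (intro always_eventually allI impI)
          fix t :: real assume "t \<noteq> s" "t \<in> {0..1}"
          then show "norm (U t j - U s j) \<le> 2 * l1 c (F t (U s))"
            using order_trans[OF norm_le_l1[OF True, of "\<lambda>j. U t j - U s j"] near[OF _ s]] by blast
        qed
      qed
      then show "((\<lambda>t. U t j) \<longlongrightarrow> U s j) (at s within {0..1})"
        by (simp add: Lim_null[symmetric] LIM_zero_iff)
    qed
  qed
  moreover have "U t = u" if "t \<in> {0..1}" "u \<in> ?D" "\<And>j. j < c \<Longrightarrow> F t u j = 0" for t u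
  proof (rule l1_cball_eqI[OF U(1)[OF that(1)] that(2)])
    show "l1 c (\<lambda>j. U t j - u j) \<le> 0"
      using contr[OF that(1) U(1)[OF that(1)] that(2)] U(2)[OF that(1)] that(3) by (simp add: l1_def)
  qed
  ultimately show ?thesis using U by blast
qed

lemma dual_basis_exists:
  fixes r :: "nat \<Rightarrow> nat \<Rightarrow> complex"
  assumes "\<And>a. (\<And>i. i < n \<Longrightarrow> (\<Sum>j<c. a j * r j i) = 0) \<Longrightarrow> (\<forall>j<c. a j = 0)"
  shows "\<exists>v. \<forall>j<c. \<forall>k<c. (\<Sum>i<n. r j i * v k i) = (if j = k then 1 else 0)"
  using assms
proof (induction c)
  case (Suc c)
  have ind: "\<forall>j<c. a j = 0" if "\<And>i. i < n \<Longrightarrow> (\<Sum>j<c. a j * r j i) = 0" for a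
  proof -
    have "\<forall>j<Suc c. (if j < c then a j else 0) = 0"
      by (rule Suc.prems) (use that in simp)
    then show ?thesis by (metis less_SucI)
  qed
  obtain v where v: "\<forall>j<c. \<forall>k<c. (\<Sum>i<n. r j i * v k i) = (if j = k then 1 else 0)"
    using Suc.IH[OF ind] by blast
  define \<phi> where "\<phi> j w = (\<Sum>i<n. r j i * w i)" for j and w :: "nat \<Rightarrow> complex"
  have v: "\<phi> j (v k) = (if j = k then 1 else 0)" if "j < c" "k < c" for j k
    using v that unfolding \<phi>_def by blast
  have "\<exists>i<n. r c i - (\<Sum>k<c. \<phi> c (v k) * r k i) \<noteq> 0"
  proof (rule ccontr)
    assume *: "\<not> (\<exists>i<n. r c i - (\<Sum>k<c. \<phi> c (v k) * r k i) \<noteq> 0)"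
    define a where "a j = (if j < c then - \<phi> c (v j) else 1)" for j
    have "(\<Sum>j<Suc c. a j * r j i) = 0" if "i < n" for i
      using * that by (simp add: a_def sum_negf)
    from Suc.prems[OF this] show False by (auto simp: a_def)
  qed
  then obtain i where i: "i < n" and "r c i - (\<Sum>k<c. \<phi> c (v k) * r k i) \<noteq> 0" by blast
  moreover define s where "s = r c i - (\<Sum>k<c. \<phi> c (v k) * r k i)"
  ultimately have s: "s \<noteq> 0" by simp
  define u where "u m = ((if m = i then 1 else 0) - (\<Sum>k<c. r k i * v k m)) / s" for m
  have \<phi>u: "\<phi> j u = (r j i - (\<Sum>k<c. r k i * \<phi> j (v k))) / s" for j
  proof -
    have "\<phi> j u = (\<Sum>m<n. (if m = i then r j m else 0) - r j m * (\<Sum>k<c. r k i * v k m)) / s"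
      unfolding \<phi>_def u_def sum_divide_distrib by (rule sum.cong) (auto simp: right_diff_distrib)
    also have "\<dots> = ((\<Sum>m<n. if m = i then r j m else 0) - (\<Sum>m<n. r j m * (\<Sum>k<c. r k i * v k m))) / s"
      by (simp only: sum_subtractf)
    also have "(\<Sum>m<n. r j m * (\<Sum>k<c. r k i * v k m)) = (\<Sum>k<c. r k i * \<phi> j (v k))"
      unfolding \<phi>_def sum_distrib_left by (subst sum.swap) (simp add: mult_ac)
    finally show ?thesis using i by simp
  qed
  have u: "\<phi> j u = 0" if "j < c" for j
  proof -
    have "(\<Sum>k<c. r k i * \<phi> j (v k)) = (\<Sum>k<c. if j = k then r k i else 0)"
      by (rule sum.cong) (use v[OF that] in auto)
    then show ?thesis unfolding \<phi>u using that by simp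
  qed
  have uc: "\<phi> c u = 1"
    unfolding \<phi>u using s by (simp add: s_def mult.commute)
  define v' where "v' k = (if k < c then (\<lambda>m. v k m - \<phi> c (v k) * u m) else u)" for k
  have "\<phi> j (\<lambda>m. w m - a * u m) = \<phi> j w - a * \<phi> j u" for j w a
    by (simp add: \<phi>_def right_diff_distrib sum_subtractf sum_distrib_left mult.left_commute)
  then have "\<phi> j (v' k) = (if j = k then 1 else 0)" if "j < Suc c" "k < Suc c" for j k
    using that v u uc by (auto simp: v'_def less_Suc_eq)
  then show ?case unfolding \<phi>_def by blast
qed simp

lemma polynomials_continuous: "g \<in> polynomials n \<Longrightarrow> continuous_on UNIV g"
  by (induction rule: polynomials.induct)
    (auto intro!: continuous_intros continuous_on_product_coordinates)

lemma polynomials_difference_quotients: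
  assumes "g \<in> polynomials n"
  shows "\<exists>Q. (\<forall>i<n. continuous_on UNIV (Q i)) \<and>
    (\<forall>x y. g x - g y = (\<Sum>i<n. Q i (x, y) * (x i - y i)))"
  using assms
proof (induction rule: polynomials.induct)
  case (const a)
  show ?case by (rule exI[of _ "\<lambda>_ _. 0"]) simp
next
  case (coord k)
  have "(\<Sum>i<n. (if i = k then 1 else 0) * (x i - y i)) = x k - y k" for x y :: "nat \<Rightarrow> complex"
    using coord by (simp add: if_distrib[of "\<lambda>z. z * _"] cong: if_cong)
  then show ?case by (intro exI[of _ "\<lambda>i _. if i = k then 1 else 0"]) auto
next
  case (add p q)
  obtain P where P: "\<forall>i<n. continuous_on UNIV (P i)"
    "\<forall>x y. p x - p y = (\<Sum>i<n. P i (x, y) * (x i - y i))" using add.IH(1) by blast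
  obtain Q where Q: "\<forall>i<n. continuous_on UNIV (Q i)"
    "\<forall>x y. q x - q y = (\<Sum>i<n. Q i (x, y) * (x i - y i))" using add.IH(2) by blast
  have "p x + q x - (p y + q y) = (\<Sum>i<n. (P i (x, y) + Q i (x, y)) * (x i - y i))" for x y
  proof -
    have "p x + q x - (p y + q y) = (p x - p y) + (q x - q y)" by simp
    then show ?thesis using P(2) Q(2) by (simp add: distrib_right sum.distrib)
  qed
  moreover have "continuous_on UNIV (\<lambda>z. P i z + Q i z)" if "i < n" for i
    using P(1) Q(1) that by (intro continuous_on_add) auto
  ultimately show ?case
    by (intro exI[of _ "\<lambda>i z. P i z + Q i z"]) blast
next
  case (mult p q)
  obtain P where P: "\<forall>i<n. continuous_on UNIV (P i)"
    "\<forall>x y. p x - p y = (\<Sum>i<n. P i (x, y) * (x i - y i))" using mult.IH(1) by blast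
  obtain Q where Q: "\<forall>i<n. continuous_on UNIV (Q i)"
    "\<forall>x y. q x - q y = (\<Sum>i<n. Q i (x, y) * (x i - y i))" using mult.IH(2) by blast
  have "p x * q x - p y * q y = (\<Sum>i<n. (p x * Q i (x, y) + q y * P i (x, y)) * (x i - y i))" for x y
  proof -
    have "p x * q x - p y * q y = p x * (q x - q y) + q y * (p x - p y)" by (simp add: algebra_simps)
    also have "\<dots> = (\<Sum>i<n. (p x * Q i (x, y) + q y * P i (x, y)) * (x i - y i))"
      using P(2) Q(2) by (simp add: sum_distrib_left sum.distrib distrib_right mult.assoc)
    finally show ?thesis .
  qed
  moreover have "continuous_on UNIV (\<lambda>z. p (fst z) * Q i z + q (snd z) * P i z)" if "i < n" for i
  proof -
    have "continuous_on UNIV (\<lambda>z :: (nat \<Rightarrow> complex) \<times> (nat \<Rightarrow> complex). p (fst z))"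
      "continuous_on UNIV (\<lambda>z :: (nat \<Rightarrow> complex) \<times> (nat \<Rightarrow> complex). q (snd z))"
      by (rule continuous_on_compose2[OF polynomials_continuous];
          use mult(1,2) in \<open>auto intro: continuous_on_fst continuous_on_snd continuous_on_id\<close>)+
    then show ?thesis using P(1) Q(1) that by (intro continuous_on_add continuous_on_mult) auto
  qed
  ultimately show ?case
    by (intro exI[of _ "\<lambda>i z. p (fst z) * Q i z + q (snd z) * P i z"]) simp
qed

lemma deriv_difference_quotients:
  fixes g :: "(nat \<Rightarrow> complex) \<Rightarrow> complex"
  assumes Q: "continuous_on UNIV (Q i)" and g: "\<And>x y. g x - g y = (\<Sum>i<n. Q i (x, y) * (x i - y i))"
    and i: "i < n"
  shows "deriv (\<lambda>t. g (x(i := t))) (x i) = Q i (x, x)"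
proof (rule DERIV_imp_deriv)
  have upd: "continuous_on UNIV (\<lambda>t. x(i := t))"
  proof (rule continuous_on_coordinatewise_then_product)
    show "continuous_on UNIV (\<lambda>t. (x(i := t)) k)" for k
      by (cases "k = i") (simp_all add: continuous_on_const continuous_on_id)
  qed
  have "g (x(i := t)) - g (x(i := x i)) = Q i (x(i := t), x) * (t - x i)" for t
  proof -
    have "g (x(i := t)) - g x = (\<Sum>k<n. if k = i then Q i (x(i := t), x) * (t - x i) else 0)"
      unfolding g by (rule sum.cong) auto
    then show ?thesis using i by simp
  qed
  moreover have "continuous_on UNIV (\<lambda>t. Q i (x(i := t), x))"
    by (rule continuous_on_compose2[OF Q continuous_on_Pair[OF upd continuous_on_const]]) simp
  then have "isCont (\<lambda>t. Q i (x(i := t), x)) (x i)"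
    by (simp add: continuous_on_eq_continuous_at)
  ultimately show "((\<lambda>t. g (x(i := t))) has_field_derivative Q i (x, x)) (at (x i))"
    unfolding CARAT_DERIV by (intro exI[of _ "\<lambda>t. Q i (x(i := t), x)"]) simp
qed

lemma affine_space_nhd:
  assumes W: "open W" and p: "p \<in> W" "p \<in> affine_space n"
  obtains \<delta> where "0 < \<delta>" and "\<And>x. x \<in> affine_space n \<Longrightarrow> (\<And>i. i < n \<Longrightarrow> norm (x i - p i) < \<delta>) \<Longrightarrow> x \<in> W"
proof -
  have "openin (product_topology (\<lambda>_. euclidean) UNIV) W"
    using W by (simp add: euclidean_product_topology)
  then have "\<exists>B. (\<forall>i. open (B i)) \<and> p \<in> Pi UNIV B \<and> Pi UNIV B \<subseteq> W"
    using p(1) unfolding openin_product_topology_alt PiE_UNIV_domain by (metis UNIV_I open_openin)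
  then obtain B where B: "\<And>i. open (B i)" "p \<in> Pi UNIV B" "Pi UNIV B \<subseteq> W" by blast
  have "\<exists>e>0. ball (p i) e \<subseteq> B i" for i
    using B(1)[of i] Pi_mem[OF B(2), of i] by (simp add: open_contains_ball)
  then obtain e where e: "\<And>i. e i > 0" "\<And>i. ball (p i) (e i) \<subseteq> B i" by metis
  define \<delta> where "\<delta> = Min (insert 1 (e ` {..<n}))"
  have \<delta>: "\<delta> > 0" "\<And>i. i < n \<Longrightarrow> \<delta> \<le> e i" using e(1) by (auto simp: \<delta>_def)
  show thesis
  proof (rule that[OF \<delta>(1)])
    fix x assume x: "x \<in> affine_space n" "\<And>i. i < n \<Longrightarrow> norm (x i - p i) < \<delta>"
    have "x i \<in> B i" for i
    proof (cases "i < n")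
      case True
      then have "x i \<in> ball (p i) (e i)" using x(2) \<delta>(2) by (force simp: dist_norm norm_minus_commute)
      then show ?thesis using e(2) by blast
    next
      case False
      then have "x i = p i" using x(1) p(2) by (simp add: affine_space_def)
      then show ?thesis using B(2) by auto
    qed
    then show "x \<in> W" using B(3) by auto
  qed
qed

lemma smooth_locus_path:
  assumes smooth: "standard_smooth n c f" and p: "p \<in> affine_space n" "\<forall>j<c. f j p = 0"
    and W: "open W" "p \<in> W"
  obtains \<delta> where "0 < \<delta>"
    and "\<And>z. z \<in> affine_space n \<Longrightarrow> (\<forall>j<c. f j z = 0) \<Longrightarrow> (\<And>i. i < n \<Longrightarrow> norm (z i - p i) < \<delta>) \<Longrightarrow>
      \<exists>g. continuous_on {0..1::real} g \<and> g 0 = p \<and> g 1 = z \<and>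
        (\<forall>t\<in>{0..1}. g t \<in> W \<and> g t \<in> affine_space n \<and> (\<forall>j<c. f j (g t) = 0))"
proof -
  have poly: "f j \<in> polynomials n" if "j < c" for j
    using smooth that by (simp add: standard_smooth_def)
  then have "\<forall>j. \<exists>Q. j < c \<longrightarrow> (\<forall>i<n. continuous_on UNIV (Q i)) \<and>
      (\<forall>x y. f j x - f j y = (\<Sum>i<n. Q i (x, y) * (x i - y i)))"
    using polynomials_difference_quotients by blast
  from choice[OF this] obtain Q where
    Qc: "\<And>j i. j < c \<Longrightarrow> i < n \<Longrightarrow> continuous_on UNIV (Q j i)"
    and Q: "\<And>j x y. j < c \<Longrightarrow> f j x - f j y = (\<Sum>i<n. Q j i (x, y) * (x i - y i))"
    by blast
  have indep: "\<forall>j<c. a j = 0" if a: "\<And>i. i < n \<Longrightarrow> (\<Sum>j<c. a j * Q j i (p, p)) = 0" for a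
  proof -
    have "(\<Sum>j<c. a j * deriv (\<lambda>t. f j (p(i := t))) (p i)) = 0" if "i < n" for i
    proof -
      have "(\<Sum>j<c. a j * deriv (\<lambda>t. f j (p(i := t))) (p i)) = (\<Sum>j<c. a j * Q j i (p, p))"
      proof (rule sum.cong)
        fix j assume "j \<in> {..<c}"
        then have j: "j < c" by simp
        show "a j * deriv (\<lambda>t. f j (p(i := t))) (p i) = a j * Q j i (p, p)"
          by (simp only: deriv_difference_quotients[OF Qc[OF j that] Q[OF j] that])
      qed simp
      then show ?thesis using a[OF that] by simp
    qed
    then show ?thesis using smooth p unfolding standard_smooth_def by blast
  qed
  from dual_basis_exists[where n = n and c = c and r = "\<lambda>j i. Q j i (p, p)", OF indep]
  obtain v where v: "\<forall>j<c. \<forall>k<c. (\<Sum>i<n. Q j i (p, p) * v k i) = (if j = k then 1 else 0)"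
    by blast
  define M where "M j k z = (if j = k then 1 else 0) - (\<Sum>i<n. Q j i z * v k i)" for j k z
  have Mc: "continuous_on UNIV (M j k)" if "j < c" for j k
    unfolding M_def using Qc[OF that] by (intro continuous_intros) auto
  define \<epsilon> where "\<epsilon> = 1 / (2 * (real c + 1))"
  have \<epsilon>: "\<epsilon> > 0" "real c * \<epsilon> \<le> 1 / 2" by (auto simp: \<epsilon>_def field_simps)
  let ?G = "\<Inter>j\<in>{..<c}. \<Inter>k\<in>{..<c}. {z. norm (M j k z) < \<epsilon>}"
  have "open ?G"
    by (intro open_INT ballI finite_lessThan open_Collect_less continuous_on_norm Mc continuous_on_const) auto
  moreover have "(p, p) \<in> ?G" using v \<epsilon>(1) by (auto simp: M_def)
  ultimately obtain A B where AB: "open A" "open B" "p \<in> A" "p \<in> B" "A \<times> B \<subseteq> ?G"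
    by (rule open_prod_elim) blast
  obtain \<rho> where \<rho>: "0 < \<rho>"
    "\<And>x. x \<in> affine_space n \<Longrightarrow> (\<And>i. i < n \<Longrightarrow> norm (x i - p i) < \<rho>) \<Longrightarrow> x \<in> W \<inter> A \<inter> B"
    using affine_space_nhd[of "W \<inter> A \<inter> B" p n] W AB p(1) by blast
  define K where "K = 1 + (\<Sum>k<c. \<Sum>i<n. norm (v k i))"
  have vK: "norm (v k i) \<le> K" if "k < c" "i < n" for k i
  proof -
    have "norm (v k i) \<le> (\<Sum>i<n. norm (v k i))" by (rule member_le_sum) (use that in auto)
    also have "\<dots> \<le> (\<Sum>k<c. \<Sum>i<n. norm (v k i))"
      by (rule member_le_sum[of k "{..<c}" "\<lambda>k. \<Sum>i<n. norm (v k i)"]) (use that in \<open>auto intro: sum_nonneg\<close>)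
    finally show ?thesis by (simp add: K_def)
  qed
  have K: "K > 0" unfolding K_def by (intro add_pos_nonneg sum_nonneg) auto
  define \<eta> where "\<eta> = \<rho> / (2 * K)"
  have \<eta>: "\<eta> > 0" "\<eta> * K = \<rho> / 2" using \<rho>(1) K by (auto simp: \<eta>_def)
  have "open {x. l1 c (\<lambda>j. f j x) < \<eta> / 2}"
    unfolding l1_def
    by (intro open_Collect_less continuous_on_const continuous_on_sum continuous_on_norm
        polynomials_continuous[OF poly]) simp
  moreover have "l1 c (\<lambda>j. f j p) < \<eta> / 2" using p(2) \<eta>(1) by (simp add: l1_def)
  ultimately obtain \<delta>0 where \<delta>0: "0 < \<delta>0"
    "\<And>x. x \<in> affine_space n \<Longrightarrow> (\<And>i. i < n \<Longrightarrow> norm (x i - p i) < \<delta>0) \<Longrightarrow> l1 c (\<lambda>j. f j x) < \<eta> / 2"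
    using affine_space_nhd[of "{x. l1 c (\<lambda>j. f j x) < \<eta> / 2}" p n] p(1) by auto
  define \<delta> where "\<delta> = min \<delta>0 (\<rho> / 2)"
  show thesis
  proof (rule that)
    show "0 < \<delta>" using \<delta>0 \<rho> by (simp add: \<delta>_def)
    fix z assume z: "z \<in> affine_space n" "\<forall>j<c. f j z = 0" "\<And>i. i < n \<Longrightarrow> norm (z i - p i) < \<delta>"
    define x where "x t i = p i + complex_of_real t * (z i - p i)" for t i
    have xp: "norm (x t i - p i) < \<delta>" if "t \<in> {0..1}" "i < n" for t i
    proof -
      have "norm (x t i - p i) = t * norm (z i - p i)" using that by (simp add: x_def norm_mult)
      also have "\<dots> \<le> norm (z i - p i)" using that by (simp add: mult_left_le_one_le)
      finally show ?thesis using z(3)[OF that(2)] by simp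
    qed
    have xa: "x t \<in> affine_space n" for t using p(1) z(1) by (simp add: affine_space_def x_def)
    define \<Phi> where "\<Phi> t u i = (if i < n then x t i + (\<Sum>k<c. u k * v k i) else 0)" for t u i
    have \<Phi>a: "\<Phi> t u \<in> affine_space n" for t u by (simp add: affine_space_def \<Phi>_def)
    have \<Phi>0: "\<Phi> t (\<lambda>_. 0) = x t" for t
      using xa[of t] by (auto simp: \<Phi>_def affine_space_def)
    have \<Phi>W: "\<Phi> t u \<in> W \<inter> A \<inter> B" if t: "t \<in> {0..1}" and u: "u \<in> l1_cball c \<eta>" for t u
    proof (rule \<rho>(2)[OF \<Phi>a])
      fix i assume i: "i < n"
      have "norm (\<Sum>k<c. u k * v k i) \<le> (\<Sum>k<c. norm (u k) * K)"
        by (rule sum_norm_le) (use vK i in \<open>auto simp: norm_mult intro!: mult_left_mono\<close>)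
      also have "\<dots> = l1 c u * K" by (simp add: l1_def sum_distrib_right)
      also have "\<dots> \<le> \<eta> * K" using u K by (intro mult_right_mono) (auto simp: l1_cball_def)
      finally have "norm (\<Sum>k<c. u k * v k i) \<le> \<rho> / 2" using \<eta>(2) by simp
      moreover have "norm (x t i - p i) < \<rho> / 2" using xp[OF t i] by (simp add: \<delta>_def)
      moreover have \<Phi>p: "\<Phi> t u i - p i = (x t i - p i) + (\<Sum>k<c. u k * v k i)" using i by (simp add: \<Phi>_def)
      ultimately show "norm (\<Phi> t u i - p i) < \<rho>"
        unfolding \<Phi>p using norm_triangle_ineq[of "x t i - p i" "\<Sum>k<c. u k * v k i"] by linarith
    qed
    have contr: "l1 c (\<lambda>j. (u j - f j (\<Phi> t u)) - (w j - f j (\<Phi> t w))) \<le> l1 c (\<lambda>j. u j - w j) / 2"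
      if t: "t \<in> {0..1}" and u: "u \<in> l1_cball c \<eta>" and w: "w \<in> l1_cball c \<eta>" for t u w
    proof -
      let ?z = "(\<Phi> t u, \<Phi> t w)"
      have "?z \<in> ?G" using AB(5) \<Phi>W[OF t u] \<Phi>W[OF t w] by blast
      then have M: "norm (M j k ?z) \<le> \<epsilon>" if "j < c" "k < c" for j k using that by force
      have "norm ((u j - f j (\<Phi> t u)) - (w j - f j (\<Phi> t w))) \<le> \<epsilon> * l1 c (\<lambda>j. u j - w j)" if j: "j < c" for j
      proof -
        have "f j (\<Phi> t u) - f j (\<Phi> t w) = (\<Sum>i<n. Q j i ?z * (\<Sum>k<c. v k i * (u k - w k)))"
          unfolding Q[OF j]
          by (rule sum.cong) (auto simp: \<Phi>_def right_diff_distrib sum_subtractf mult.commute)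
        also have "\<dots> = (\<Sum>k<c. (\<Sum>i<n. Q j i ?z * v k i) * (u k - w k))"
          unfolding sum_distrib_left sum_distrib_right by (subst sum.swap) (simp add: mult.assoc)
        finally have "(u j - f j (\<Phi> t u)) - (w j - f j (\<Phi> t w)) =
            (u j - w j) - (\<Sum>k<c. (\<Sum>i<n. Q j i ?z * v k i) * (u k - w k))"
          by (simp add: algebra_simps)
        also have "u j - w j = (\<Sum>k<c. (if j = k then 1 else 0) * (u k - w k))"
          using j by (simp add: if_distrib[of "\<lambda>z. z * _"] cong: if_cong)
        also have "\<dots> - (\<Sum>k<c. (\<Sum>i<n. Q j i ?z * v k i) * (u k - w k)) = (\<Sum>k<c. M j k ?z * (u k - w k))"
          by (simp only: M_def left_diff_distrib sum_subtractf)
        also have "norm \<dots> \<le> (\<Sum>k<c. \<epsilon> * norm (u k - w k))"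
          by (rule sum_norm_le) (use M[OF j] in \<open>auto simp: norm_mult intro!: mult_right_mono\<close>)
        also have "\<dots> = \<epsilon> * l1 c (\<lambda>j. u j - w j)" by (simp add: l1_def sum_distrib_left)
        finally show ?thesis .
      qed
      then have "l1 c (\<lambda>j. (u j - f j (\<Phi> t u)) - (w j - f j (\<Phi> t w))) \<le> (\<Sum>j<c. \<epsilon> * l1 c (\<lambda>j. u j - w j))"
        unfolding l1_def[of c "\<lambda>j. (u j - f j (\<Phi> t u)) - (w j - f j (\<Phi> t w))"] by (intro sum_mono) simp
      also have "\<dots> = (real c * \<epsilon>) * l1 c (\<lambda>j. u j - w j)" by simp
      also have "\<dots> \<le> (1 / 2) * l1 c (\<lambda>j. u j - w j)"
        by (rule mult_right_mono[OF \<epsilon>(2) l1_nonneg])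
      finally show ?thesis by simp
    qed
    have \<Phi>c: "continuous_on S (\<lambda>s. \<Phi> (\<tau> s) (y s))"
      if "continuous_on S \<tau>" "\<And>k. continuous_on S (\<lambda>s. y s k)" for S \<tau> and y :: "'s::topological_space \<Rightarrow> _"
    proof (rule continuous_on_coordinatewise_then_product)
      show "continuous_on S (\<lambda>s. \<Phi> (\<tau> s) (y s) i)" for i
        unfolding \<Phi>_def x_def using that by (cases "i < n") (auto intro!: continuous_intros)
    qed
    have cu: "continuous_on UNIV (\<lambda>u. f j (\<Phi> t u))" if "j < c" for t j
      by (rule continuous_on_compose2[OF polynomials_continuous[OF poly[OF that]] \<Phi>c])
        (auto intro: continuous_on_const continuous_on_product_coordinates)
    have ct: "continuous_on {0..1} (\<lambda>t. f j (\<Phi> t u))" if "j < c" for u j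
      by (rule continuous_on_compose2[OF polynomials_continuous[OF poly[OF that]] \<Phi>c])
        (auto intro: continuous_on_const continuous_on_id)
    have small: "l1 c (\<lambda>j. f j (\<Phi> t (\<lambda>_. 0))) \<le> \<eta> / 2" if "t \<in> {0..1}" for t
      unfolding \<Phi>0 using \<delta>0(2)[OF xa] xp[OF that] by (fastforce simp: \<delta>_def)
    obtain U where Uc: "\<And>j. continuous_on {0..1} (\<lambda>t. U t j)"
      and U: "\<And>t. t \<in> {0..1} \<Longrightarrow> U t \<in> l1_cball c \<eta> \<and> (\<forall>j<c. f j (\<Phi> t (U t)) = 0) \<and>
        (\<forall>u\<in>l1_cball c \<eta>. (\<forall>j<c. f j (\<Phi> t u) = 0) \<longrightarrow> U t = u)"
      using parametrized_zero[of \<eta> c "\<lambda>t u j. f j (\<Phi> t u)", OF less_imp_le[OF \<eta>(1)] cu ct contr small]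
      by blast
    have x01: "x 0 = p" "x 1 = z" by (auto simp: x_def)
    have o: "(\<lambda>_. 0) \<in> l1_cball c \<eta>" using \<eta>(1) by (simp add: l1_cball_def l1_def)
    have U01: "U 0 = (\<lambda>_. 0)" "U 1 = (\<lambda>_. 0)"
      using U[of 0] U[of 1] o \<Phi>0 x01 p(2) z(2) by simp_all
    have "continuous_on {0..1} (\<lambda>t. \<Phi> t (U t))"
      by (rule \<Phi>c[OF continuous_on_id Uc])
    moreover have "\<Phi> 0 (U 0) = p" "\<Phi> 1 (U 1) = z" using U01 \<Phi>0 x01 by simp_all
    ultimately show "\<exists>g. continuous_on {0..1::real} g \<and> g 0 = p \<and> g 1 = z \<and>
        (\<forall>t\<in>{0..1}. g t \<in> W \<and> g t \<in> affine_space n \<and> (\<forall>j<c. f j (g t) = 0))"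
      using U \<Phi>W \<Phi>a by (intro exI[of _ "\<lambda>t. \<Phi> t (U t)"]) simp
  qed
qed

lemma smooth_locus_locally_path_connected:
  assumes "standard_smooth n c f"
  shows "locally_path_connected_space (top_of_set {x \<in> affine_space n. \<forall>j<c. f j x = 0})"
    (is "locally_path_connected_space (top_of_set ?Z)")
  unfolding locally_path_connected_space_im_kleinen
proof (intro allI impI, elim conjE)
  fix V p assume "openin (top_of_set ?Z) V" and pV: "p \<in> V"
  then obtain W where W: "open W" "V = ?Z \<inter> W" unfolding openin_open by blast
  with pV have p: "p \<in> affine_space n" "\<forall>j<c. f j p = 0" "p \<in> W" by auto
  obtain \<delta> where \<delta>: "0 < \<delta>"
    "\<And>z. z \<in> affine_space n \<Longrightarrow> (\<forall>j<c. f j z = 0) \<Longrightarrow> (\<And>i. i < n \<Longrightarrow> norm (z i - p i) < \<delta>) \<Longrightarrow>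
      \<exists>g. continuous_on {0..1::real} g \<and> g 0 = p \<and> g 1 = z \<and>
        (\<forall>t\<in>{0..1}. g t \<in> W \<and> g t \<in> affine_space n \<and> (\<forall>j<c. f j (g t) = 0))"
    using smooth_locus_path[OF assms p(1,2) W(1) p(3)] by blast
  let ?N = "\<Inter>i\<in>{..<n}. {x. norm (x i - p i) < \<delta>}"
  have "open ?N"
    by (intro open_INT ballI finite_lessThan open_Collect_less continuous_intros continuous_on_product_coordinates)
  then have "openin (top_of_set ?Z) (V \<inter> ?N)"
    using W by (auto simp: openin_open intro!: exI[of _ "W \<inter> ?N"])
  moreover have "p \<in> V \<inter> ?N" using pV \<delta>(1) by simp
  moreover have "\<exists>C. path_connectedin (top_of_set ?Z) C \<and> C \<subseteq> V \<and> p \<in> C \<and> y \<in> C" if "y \<in> V \<inter> ?N" for y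
  proof -
    from that W(2) \<delta>(2)[of y] obtain g where g: "continuous_on {0..1::real} g" "g 0 = p" "g 1 = y"
      "\<forall>t\<in>{0..1}. g t \<in> W \<and> g t \<in> affine_space n \<and> (\<forall>j<c. f j (g t) = 0)" by auto
    have "path_connected (g ` {0..1})"
      by (rule path_connected_continuous_image[OF g(1)]) simp
    moreover have "g ` {0..1} \<subseteq> V" using g(4) W(2) by auto
    moreover have "p \<in> g ` {0..1}" "y \<in> g ` {0..1}" using g(2,3) by force+
    ultimately show ?thesis using W(2) 
      by (intro exI[of _ "g ` {0..1}"]) (auto simp: path_connectedin_subtopology)
  qed
  ultimately show "\<exists>U. openin (top_of_set ?Z) U \<and> p \<in> U \<and> U \<subseteq> V \<and>
      (\<forall>y\<in>U. \<exists>C. path_connectedin (top_of_set ?Z) C \<and> C \<subseteq> V \<and> p \<in> C \<and> y \<in> C)"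
    by (intro exI[of _ "V \<inter> ?N"]) blast
qed

section \<open>The classical topology\<close>

lemma regular_const:
  assumes "sheaf_of_functions X" and "zopen X U"
  shows "regular X U (\<lambda>_. c)"
  using assms unfolding sheaf_of_functions_def by blast

lemma openin_classical:
  "zopen X U \<Longrightarrow> regular X U f \<Longrightarrow> open S \<Longrightarrow> openin (classical X) {x \<in> U. f x \<in> S}"
  unfolding classical_def by (rule topology_generated_by_Basis) blast

lemma topspace_classical:
  assumes "regular X (points X) (\<lambda>_. c)"
  shows "topspace (classical X) = points X"
proof
  show "topspace (classical X) \<subseteq> points X"
    using openin_subset by (fastforce simp: classical_def)
  have "openin (classical X) {x \<in> points X. c \<in> UNIV}"
    using assms by (rule openin_classical[OF openin_topspace]) simp
  then show "points X \<subseteq> topspace (classical X)"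
    using openin_subset by fastforce
qed

lemma continuous_map_into_classical:
  assumes "regular Y (points Y) (\<lambda>_. c)" and "\<And>x. x \<in> topspace T \<Longrightarrow> \<phi> x \<in> points Y"
    and "\<And>U f S. zopen Y U \<Longrightarrow> regular Y U f \<Longrightarrow> open S \<Longrightarrow>
      openin T {x \<in> topspace T. \<phi> x \<in> U \<and> f (\<phi> x) \<in> S}"
  shows "continuous_map T (classical Y) \<phi>"
  unfolding classical_def
proof (rule continuous_on_generated_topo)
  fix A assume "A \<in> {{x \<in> U. f x \<in> S} |U f S. zopen Y U \<and> regular Y U f \<and> open S}"
  then obtain U f S where A: "A = {x \<in> U. f x \<in> S}" "zopen Y U" "regular Y U f" "open S" by blast
  have "\<phi> -` A \<inter> topspace T = {x \<in> topspace T. \<phi> x \<in> U \<and> f (\<phi> x) \<in> S}" using A(1) by auto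
  then show "openin T (\<phi> -` A \<inter> topspace T)" using assms(3)[OF A(2-4)] by simp
next
  have "points Y \<subseteq> topspace (classical Y)" using topspace_classical[OF assms(1)] by simp
  then show "\<phi> ` topspace T \<subseteq> \<Union> {{x \<in> U. f x \<in> S} |U f S. zopen Y U \<and> regular Y U f \<and> open S}"
    using assms(2) unfolding classical_def topology_generated_by_topspace by blast
qed

lemma morphism_continuous_classical:
  assumes \<phi>: "morphism X Y \<phi>" and "regular X (points X) (\<lambda>_. c)" and "regular Y (points Y) (\<lambda>_. d)"
  shows "continuous_map (classical X) (classical Y) \<phi>"
proof (rule continuous_map_into_classical[OF assms(3)])
  have T: "topspace (classical X) = points X" by (rule topspace_classical[OF assms(2)])
  have cont: "continuous_map (zariski X) (zariski Y) \<phi>" using \<phi> by (simp add: morphism_def)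
  show "\<phi> x \<in> points Y" if "x \<in> topspace (classical X)" for x
    using cont that T by (auto simp: continuous_map_def Pi_iff)
  fix U f S assume U: "zopen Y U" "regular Y U f" "open (S :: complex set)"
  have "openin (classical X) {x \<in> {x \<in> points X. \<phi> x \<in> U}. (f \<circ> \<phi>) x \<in> S}"
  proof (rule openin_classical)
    show "zopen X {x \<in> points X. \<phi> x \<in> U}" using openin_continuous_map_preimage[OF cont U(1)] .
    show "regular X {x \<in> points X. \<phi> x \<in> U} (f \<circ> \<phi>)" using \<phi> U by (simp add: morphism_def)
  qed (rule U(3))
  then show "openin (classical X) {x \<in> topspace (classical X). \<phi> x \<in> U \<and> f (\<phi> x) \<in> S}"
    by (simp add: T conj_assoc)
qed

lemma isomorphic_classical_homeomorphic:
  assumes "isomorphic_spaces X Y" and "regular X (points X) (\<lambda>_. c)" and "regular Y (points Y) (\<lambda>_. d)"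
  shows "classical X homeomorphic_space classical Y"
proof -
  obtain \<phi> \<psi> where "morphism X Y \<phi>" "morphism Y X \<psi>"
    "\<forall>x\<in>points X. \<psi> (\<phi> x) = x" "\<forall>y\<in>points Y. \<phi> (\<psi> y) = y"
    using assms(1) unfolding isomorphic_spaces_def isomorphism_def by blast
  moreover from this have "continuous_map (classical X) (classical Y) \<phi>" "continuous_map (classical Y) (classical X) \<psi>"
    using morphism_continuous_classical[OF _ assms(2,3)] morphism_continuous_classical[OF _ assms(3,2)]
    by blast+
  ultimately have "homeomorphic_maps (classical X) (classical Y) \<phi> \<psi>"
    by (simp add: homeomorphic_maps_def topspace_classical[OF assms(2)] topspace_classical[OF assms(3)])
  then show ?thesis by (auto simp: homeomorphic_space_def)
qed

lemma classical_open_subspace: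
  assumes sheaf: "sheaf_of_functions X" and U: "zopen X U"
  shows "classical (open_subspace X U) = subtopology (classical X) U"
proof -
  let ?XU = "open_subspace X U"
  note const = regular_const[OF sheaf, of _ 0]
  have "\<forall>U V f. zopen X U \<and> zopen X V \<and> V \<subseteq> U \<and> regular X U f \<longrightarrow> regular X V f"
    using sheaf unfolding sheaf_of_functions_def by (elim conjE) assumption
  then have restrict: "regular X V f" if "zopen X W" "zopen X V" "V \<subseteq> W" "regular X W f" for V W f
    using that by blast
  have pU: "points ?XU = U" using openin_subset[OF U] by (auto simp: open_subspace_def)
  have cU: "regular ?XU (points ?XU) (\<lambda>_. 0)"
    unfolding pU using const[OF U] by (simp add: open_subspace_def)
  have TX: "topspace (classical X) = points X" by (rule topspace_classical[OF const[OF openin_topspace]])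
  have TU: "topspace (classical ?XU) = U" using topspace_classical[OF cU] pU by simp
  have tU: "topspace (subtopology (classical X) U) = U" using TX openin_subset[OF U] by auto
  have "continuous_map (subtopology (classical X) U) (classical ?XU) id"
  proof (rule continuous_map_into_classical[OF cU])
    fix V f S assume V: "zopen ?XU V" "regular ?XU V f" "open (S :: complex set)"
    then have "zopen X V" "V \<subseteq> U" "regular X V f"
      using U by (auto simp: open_subspace_def openin_open_subtopology)
    then have "openin (classical X) {x \<in> V. f x \<in> S}" "{x \<in> V. f x \<in> S} \<subseteq> U"
      using openin_classical V(3) by auto
    moreover have "{x \<in> U. id x \<in> V \<and> f (id x) \<in> S} = {x \<in> V. f x \<in> S} \<inter> U"
      using \<open>V \<subseteq> U\<close> by auto
    ultimately show "openin (subtopology (classical X) U)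
        {x \<in> topspace (subtopology (classical X) U). id x \<in> V \<and> f (id x) \<in> S}"
      unfolding tU by (auto simp: openin_subtopology)
  qed (use tU pU in auto)
  moreover have "continuous_map (classical ?XU) (subtopology (classical X) U) id"
  proof (rule continuous_map_into_subtopology)
    show "continuous_map (classical ?XU) (classical X) id"
    proof (rule continuous_map_into_classical[OF const[OF openin_topspace]])
      fix V f S assume V: "zopen X V" "regular X V f" "open (S :: complex set)"
      have "zopen X (V \<inter> U)" using V(1) U by blast
      then have "zopen ?XU (V \<inter> U)" "regular ?XU (V \<inter> U) f"
        using restrict[OF V(1) _ _ V(2)] U by (auto simp: open_subspace_def openin_open_subtopology)
      from openin_classical[OF this V(3)]
      have "openin (classical ?XU) {x \<in> V \<inter> U. f x \<in> S}" .
      moreover have "{x \<in> topspace (classical ?XU). id x \<in> V \<and> f (id x) \<in> S} = {x \<in> V \<inter> U. f x \<in> S}"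
        unfolding TU by auto
      ultimately show "openin (classical ?XU) {x \<in> topspace (classical ?XU). id x \<in> V \<and> f (id x) \<in> S}"
        by simp
    qed (use TU openin_subset[OF U] in auto)
  qed (use TU in auto)
  ultimately have "homeomorphic_maps (classical ?XU) (subtopology (classical X) U) id id"
    by (simp add: homeomorphic_maps_def)
  then show ?thesis using homeomorphic_maps_id by metis
qed

lemma classical_affine_variety:
  assumes V: "V \<subseteq> affine_space n"
  shows "classical (affine_variety n V) = top_of_set V"
    and "regular (affine_variety n V) (points (affine_variety n V)) (\<lambda>_. 0)"
proof -
  let ?A = "affine_variety n V"
  have T0: "topspace (affine_zariski n) = affine_space n"
    unfolding affine_zariski_def topology_generated_by_topspace
    using polynomials.const[of 1 n] by auto
  have pV: "points ?A = V" using V by (auto simp: affine_variety_def T0)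
  have whole: "openin (subtopology (affine_zariski n) V) V"
    using openin_topspace[of "subtopology (affine_zariski n) V"] V T0 by (simp add: Int_absorb1)
  have reg: "regular ?A V g" if "g \<in> polynomials n" for g
  proof -
    have "\<exists>p\<in>polynomials n. \<exists>q\<in>polynomials n. \<forall>z\<in>V. q z \<noteq> 0 \<and> g z = p z / q z"
      using that polynomials.const[of 1 n] by (intro bexI[of _ g] bexI[of _ "\<lambda>_. 1"]) auto
    then show ?thesis using whole by (auto simp: affine_variety_def)
  qed
  show c0: "regular ?A (points ?A) (\<lambda>_. 0)" unfolding pV by (rule reg[OF polynomials.const])
  have TA: "topspace (classical ?A) = V" using topspace_classical[OF c0] pV by simp
  have "continuous_map (top_of_set (affine_space n)) (affine_zariski n) id"
    unfolding affine_zariski_def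
  proof (rule continuous_on_generated_topo)
    fix A assume "A \<in> (\<lambda>p. {x \<in> affine_space n. p x \<noteq> 0}) ` polynomials n"
    then obtain p where p: "p \<in> polynomials n" "A = {x \<in> affine_space n. p x \<noteq> 0}" by blast
    have "open {x. p x \<noteq> 0}" by (intro open_Collect_neq polynomials_continuous[OF p(1)] continuous_on_const)
    then show "openin (top_of_set (affine_space n)) (id -` A \<inter> topspace (top_of_set (affine_space n)))"
      unfolding openin_open using p(2) by (intro exI[of _ "{x. p x \<noteq> 0}"]) auto
  qed (use T0[unfolded affine_zariski_def topology_generated_by_topspace] in auto)
  then have "continuous_map (top_of_set V) (subtopology (affine_zariski n) V) id"
    using V continuous_map_from_subtopology_mono
    by (fastforce intro!: continuous_map_into_subtopology)
  then have zo: "openin (top_of_set V) W" if "openin (subtopology (affine_zariski n) V) W" for W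
  proof -
    have "openin (top_of_set V) {x \<in> topspace (top_of_set V). id x \<in> W}"
      using openin_continuous_map_preimage \<open>continuous_map (top_of_set V) (subtopology (affine_zariski n) V) id\<close> that by blast
    moreover have "{x \<in> topspace (top_of_set V). id x \<in> W} = W" using openin_subset[OF that] by auto
    ultimately show ?thesis by simp
  qed
  have "continuous_map (top_of_set V) (classical ?A) id"
  proof (rule continuous_map_into_classical[OF c0])
    fix U f S assume U: "zopen ?A U" "regular ?A U f" "open (S :: complex set)"
    have "openin (top_of_set V) {x \<in> U. f x \<in> S}"
    proof (subst openin_subopen, intro ballI)
      fix x assume x: "x \<in> {x \<in> U. f x \<in> S}"
      then obtain W p q where W: "openin (subtopology (affine_zariski n) V) W" "x \<in> W" "W \<subseteq> U"
        and pq: "p \<in> polynomials n" "q \<in> polynomials n" "\<forall>z\<in>W. q z \<noteq> 0 \<and> f z = p z / q z"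
        using U(2) by (auto simp: affine_variety_def)
      have "continuous_on W (\<lambda>z. p z / q z)"
        using pq by (intro continuous_on_divide continuous_on_subset[OF polynomials_continuous]) auto
      then have "continuous_on W f" using pq(3) by (simp cong: continuous_on_cong)
      then have "openin (top_of_set W) (W \<inter> f -` S)" using U(3) by (rule continuous_openin_preimage_gen)
      then have "openin (top_of_set V) (W \<inter> f -` S)" using zo[OF W(1)] openin_trans by blast
      then show "\<exists>N. openin (top_of_set V) N \<and> x \<in> N \<and> N \<subseteq> {x \<in> U. f x \<in> S}"
        using x W by (intro exI[of _ "W \<inter> f -` S"]) auto
    qed
    moreover have "{x \<in> topspace (top_of_set V). id x \<in> U \<and> f (id x) \<in> S} = {x \<in> U. f x \<in> S}"
      using openin_subset[OF U(1)] pV by auto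
    ultimately show "openin (top_of_set V) {x \<in> topspace (top_of_set V). id x \<in> U \<and> f (id x) \<in> S}" by simp
  qed (use pV in auto)
  moreover have "continuous_map (classical ?A) (top_of_set V) id"
  proof (rule continuous_map_into_subtopology)
    have "continuous_map (classical ?A) euclidean (\<lambda>x. x i)" for i
    proof -
      let ?g = "if i < n then (\<lambda>x. x i) else (\<lambda>_. 0) :: (nat \<Rightarrow> complex) \<Rightarrow> complex"
      have g: "?g \<in> polynomials n" using polynomials.const polynomials.coord by auto
      have xi: "x i = ?g x" if "x \<in> V" for x using that V by (auto simp: affine_space_def)
      have "openin (classical ?A) {x \<in> V. x i \<in> S}" if "open S" for S
      proof -
        have "openin (classical ?A) {x \<in> V. ?g x \<in> S}"
          using openin_classical[OF _ reg[OF g] that] openin_topspace[of "zariski ?A"] unfolding pV by blast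
        moreover have "{x \<in> V. ?g x \<in> S} = {x \<in> V. x i \<in> S}" using xi by (metis (no_types, lifting))
        ultimately show ?thesis by simp
      qed
      then show ?thesis by (simp add: continuous_map TA)
    qed
    then show "continuous_map (classical ?A) euclidean id"
      unfolding euclidean_product_topology[symmetric] continuous_map_componentwise_UNIV by simp
  qed (use TA in auto)
  ultimately have "homeomorphic_maps (classical ?A) (top_of_set V) id id"
    by (simp add: homeomorphic_maps_def)
  then show "classical ?A = top_of_set V" using homeomorphic_maps_id by metis
qed

lemma locally_path_connected_space_local:
  assumes "\<And>x. x \<in> topspace X \<Longrightarrow> \<exists>U. openin X U \<and> x \<in> U \<and> locally_path_connected_space (subtopology X U)"
  shows "locally_path_connected_space X"
  unfolding locally_path_connected_space
proof (intro allI impI, elim conjE)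
  fix W x assume W: "openin X W" "x \<in> W"
  then obtain U where U: "openin X U" "x \<in> U" "locally_path_connected_space (subtopology X U)"
    using assms[of x] openin_subset[OF W(1)] by blast
  have "openin (subtopology X U) (W \<inter> U)" using W(1) by (rule openin_subtopology_Int)
  then obtain N where N: "openin (subtopology X U) N" "path_connectedin (subtopology X U) N" "x \<in> N" "N \<subseteq> W \<inter> U"
    using U(3)[unfolded locally_path_connected_space, rule_format, of "W \<inter> U" x] U(2) W(2) by blast
  then show "\<exists>N. openin X N \<and> path_connectedin X N \<and> x \<in> N \<and> N \<subseteq> W"
    using U(1) by (auto simp: openin_open_subtopology path_connectedin_subtopology)
qed

lemma locally_path_connected_classical:
  assumes sheaf: "sheaf_of_functions Y" and smooth: "smooth Y"
  shows "locally_path_connected_space (classical Y)"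
proof (rule locally_path_connected_space_local)
  note const = regular_const[OF sheaf, of _ 0]
  fix p assume "p \<in> topspace (classical Y)"
  then have "p \<in> points Y" using topspace_classical[OF const[OF openin_topspace]] by simp
  then obtain U n c f where U: "zopen Y U" "p \<in> U" and f: "standard_smooth n c f"
    and iso: "isomorphic_spaces (open_subspace Y U) (affine_variety n {x \<in> affine_space n. \<forall>j<c. f j x = 0})"
    using smooth unfolding smooth_def by blast
  let ?Z = "{x \<in> affine_space n. \<forall>j<c. f j x = 0}"
  have Z: "?Z \<subseteq> affine_space n" by blast
  have "points (open_subspace Y U) = U" using openin_subset[OF U(1)] by (auto simp: open_subspace_def)
  then have "regular (open_subspace Y U) (points (open_subspace Y U)) (\<lambda>_. 0)"
    using const[OF U(1)] by (simp add: open_subspace_def)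
  then have "classical (open_subspace Y U) homeomorphic_space classical (affine_variety n ?Z)"
    by (rule isomorphic_classical_homeomorphic[OF iso _ classical_affine_variety(2)[OF Z]])
  then have "subtopology (classical Y) U homeomorphic_space top_of_set ?Z"
    unfolding classical_open_subspace[OF sheaf U(1)] classical_affine_variety(1)[OF Z] .
  then have "locally_path_connected_space (subtopology (classical Y) U)"
    using homeomorphic_locally_path_connected_space smooth_locus_locally_path_connected[OF f] by blast
  moreover have "openin (classical Y) U"
    using openin_classical[OF U(1) const[OF U(1)] open_UNIV] by simp
  ultimately show "\<exists>U. openin (classical Y) U \<and> p \<in> U \<and> locally_path_connected_space (subtopology (classical Y) U)"
    using U(2) by blast
qed

lemma locally_path_connected_complement:
  assumes sheaf: "sheaf_of_functions Y" and smooth: "smooth Y" and B: "reduced_divisor Y B"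
  shows "locally_path_connected_space (complement Y B)"
proof -
  have "closedin (zariski Y) B"
    using B by (auto simp: reduced_divisor_def prime_divisor_def intro!: closedin_Union)
  then have "zopen Y (points Y - B)" by blast
  from openin_classical[OF this regular_const[OF sheaf this] open_UNIV]
  have "openin (classical Y) (points Y - B)" by (simp add: set_diff_eq)
  then show ?thesis
    unfolding complement_def
    by (rule locally_path_connected_space_open_subset[OF locally_path_connected_classical[OF sheaf smooth]])
qed

lemma variety_topspace_classical:
  assumes "variety X"
  shows "topspace (classical X) = points X"
proof -
  have "sheaf_of_functions X" using assms by (simp add: variety_def)
  then show ?thesis by (rule topspace_classical[OF regular_const[OF _ openin_topspace]])
qed

section \<open>Invariance of the connected number\<close>

theorem proposition2p3:
  fixes Y :: "'a space_with_functions"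
    and X1 :: "'b space_with_functions" and X2 :: "'c space_with_functions"
    and \<phi>1 :: "'b \<Rightarrow> 'a" and \<phi>2 :: "'c \<Rightarrow> 'a"
    and B1 B2 C1 C2 :: "'a set" and b1 b2 :: 'a
    and G :: "'g monoid"
    and \<theta>1 \<theta>2 :: "(real \<Rightarrow> 'a) set \<Rightarrow> 'g"
    and h :: "'a \<Rightarrow> 'a" and \<gamma> :: "real \<Rightarrow> 'a" and \<sigma> :: "'g \<Rightarrow> 'g"
  assumes "variety Y" and "smooth Y"
    and "reduced_divisor Y B1" and "reduced_divisor Y B2"
    and "group G" and "finite (carrier G)"
    and "b1 \<in> points Y - B1" and "b2 \<in> points Y - B2"
    and "\<theta>1 \<in> epi (fundamental_group (complement Y B1) b1) G"
    and "\<theta>2 \<in> epi (fundamental_group (complement Y B2) b2) G"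
    and "induced_cover X1 Y \<phi>1 B1 b1 G \<theta>1"
    and "induced_cover X2 Y \<phi>2 B2 b2 G \<theta>2"
    and "closedin (zariski Y) C1"
    and "\<And>Z. irreducible_component (zariski Y) C1 Z \<Longrightarrow> \<not> Z \<subseteq> B1"
    and "connectedin (classical Y) (C1 - B1)"
    and "homeomorphic_map (classical Y) (classical Y) h" and "h ` B1 = B2"
    and "pathin (complement Y B2) \<gamma>" and "\<gamma> 0 = b2" and "\<gamma> 1 = h b1"
    and "\<sigma> \<in> iso G G"
    and "\<And>A. A \<in> carrier (fundamental_group (complement Y B1) b1) \<Longrightarrow>
           \<sigma> (\<theta>2 (induced_map (complement Y B2) b2 \<gamma> h A)) = \<theta>1 A"
    and "C2 = h ` C1"
  shows "connected_number X1 \<phi>1 B1 C1 = connected_number X2 \<phi>2 B2 C2"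
proof -
  define T1 T2 E1 E2 where "T1 = complement Y B1" and "T2 = complement Y B2"
    and "E1 = cover_complement X1 Y \<phi>1 B1" and "E2 = cover_complement X2 Y \<phi>2 B2"
  note TE = T1_def T2_def E1_def E2_def
  have sheaf: "sheaf_of_functions Y" using assms(1) by (simp add: variety_def)
  have lpc: "locally_path_connected_space T1" "locally_path_connected_space T2"
    unfolding TE using locally_path_connected_complement[OF sheaf assms(2)] assms(3,4) by blast+
  have cov: "covering_map E1 T1 \<phi>1" "covering_map E2 T2 \<phi>2"
    and conn: "connected_space E1" "connected_space E2" and vX: "variety X1" "variety X2"
    using assms(11,12) by (simp_all add: induced_cover_def TE)
  obtain x1 where x1: "x1 \<in> points X1" "\<phi>1 x1 = b1"
    "induced_map T1 b1 (\<lambda>_. b1) \<phi>1 ` carrier (fundamental_group E1 x1) = kernel (fundamental_group T1 b1) G \<theta>1"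
    using assms(11) unfolding induced_cover_def TE by blast
  obtain x2 where x2: "x2 \<in> points X2" "\<phi>2 x2 = b2"
    "induced_map T2 b2 (\<lambda>_. b2) \<phi>2 ` carrier (fundamental_group E2 x2) = kernel (fundamental_group T2 b2) G \<theta>2"
    using assms(12) unfolding induced_cover_def TE by blast
  have tY: "topspace (classical Y) = points Y" by (rule variety_topspace_classical[OF assms(1)])
  have tE1: "topspace E1 = {x \<in> points X1. \<phi>1 x \<in> points Y - B1}"
    and tE2: "topspace E2 = {x \<in> points X2. \<phi>2 x \<in> points Y - B2}"
    using variety_topspace_classical[OF vX(1)] variety_topspace_classical[OF vX(2)]
    by (auto simp: TE cover_complement_def)
  have xE: "x1 \<in> topspace E1" "x2 \<in> topspace E2" using x1 x2 assms(7,8) by (auto simp: tE1 tE2)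
  obtain k where hk0: "homeomorphic_maps (classical Y) (classical Y) h k"
    using assms(16) homeomorphic_map_maps by blast
  have B1: "B1 \<subseteq> points Y"
    using assms(3) closedin_subset by (fastforce simp: reduced_divisor_def prime_divisor_def)
  have C1: "C1 \<subseteq> points Y" using closedin_subset[OF assms(13)] .
  have inj: "inj_on h (points Y)" and surj: "h ` points Y = points Y"
    using assms(16) tY homeomorphic_imp_injective_map homeomorphic_imp_surjective_map by fastforce+
  have hdiff: "h ` (A - B1) = h ` A - B2" if "A \<subseteq> points Y" for A
    using inj_on_image_set_diff[OF inj, of A B1] that B1 assms(17) by auto
  have hk: "homeomorphic_maps T1 T2 h k"
    unfolding TE complement_def
    by (rule homeomorphic_maps_subtopologies[OF hk0]) (simp add: tY Int_absorb1 hdiff surj)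
  then have h: "continuous_map T1 T2 h" "continuous_map T2 T1 k"
    "\<And>y. y \<in> topspace T1 \<Longrightarrow> k (h y) = y" "\<And>y. y \<in> topspace T2 \<Longrightarrow> h (k y) = y"
    by (auto simp: homeomorphic_maps_def)
  have b1T: "b1 \<in> topspace T1" using assms(7) tY by (simp add: TE complement_def)
  have \<gamma>: "pathin T2 \<gamma>" "\<gamma> 0 = b2" "\<gamma> 1 = h b1" using assms(18-20) by (simp_all add: TE)
  obtain d where d: "pathin E2 d" "d 0 = x2" "\<And>t. t \<in> {0..1} \<Longrightarrow> \<phi>2 (d t) = \<gamma> t"
    using path_lift_exists[OF cov(2) \<gamma>(1) xE(2)] x2(2) \<gamma>(2) by auto
  define y2 where "y2 = d 1"
  have y2: "y2 \<in> topspace E2" "\<phi>2 y2 = h b1"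
    using path_finish_in_topspace[OF d(1)] d(3)[of 1] \<gamma>(3) by (auto simp: y2_def)

  have key: "lifts_to_loop E1 \<phi>1 x1 w \<longleftrightarrow> lifts_to_loop E2 \<phi>2 y2 (h \<circ> w)" if w: "w \<in> loops T1 b1" for w
  proof -
    let ?m = "path_join \<gamma> (path_join (h \<circ> w) (path_reverse \<gamma>))"
    have hw: "pathin T2 (h \<circ> w)" "(h \<circ> w) 0 = \<gamma> 1" "(h \<circ> w) 1 = \<gamma> 1"
      using w h(1) \<gamma>(3) by (auto simp: loops_def intro: pathin_compose)
    then have m: "?m \<in> loops T2 b2"
      using \<gamma> by (auto simp: loops_def intro!: pathin_path_join pathin_path_reverse)
    have wc: "loop_class T1 b1 w \<in> carrier (fundamental_group T1 b1)"
      using w by (simp add: fundamental_group_def)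
    have "\<theta>1 (loop_class T1 b1 w) = \<sigma> (\<theta>2 (induced_map T2 b2 \<gamma> h (loop_class T1 b1 w)))"
      using assms(22) wc by (simp add: TE)
    also have "induced_map T2 b2 \<gamma> h (loop_class T1 b1 w) = loop_class T2 b2 ?m"
      by (rule induced_map_loop_class[OF h(1) \<gamma> w])
    finally have \<theta>: "\<theta>1 (loop_class T1 b1 w) = \<sigma> (\<theta>2 (loop_class T2 b2 ?m))" .
    have "loop_class T2 b2 ?m \<in> carrier (fundamental_group T2 b2)"
      using m by (simp add: fundamental_group_def)
    then have mG: "\<theta>2 (loop_class T2 b2 ?m) \<in> carrier G"
      using assms(10) by (auto simp: epi_def hom_def TE)
    have "\<sigma> \<one>\<^bsub>G\<^esub> = \<one>\<^bsub>G\<^esub>" "inj_on \<sigma> (carrier G)"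
      using assms(5,21) hom_one by (auto simp: iso_def bij_betw_def)
    then have "\<theta>1 (loop_class T1 b1 w) = \<one>\<^bsub>G\<^esub> \<longleftrightarrow> \<theta>2 (loop_class T2 b2 ?m) = \<one>\<^bsub>G\<^esub>"
      using \<theta> mG inj_onD[of \<sigma> "carrier G"] monoid.one_closed[OF group.is_monoid[OF assms(5)]] by metis
    then have "lifts_to_loop E1 \<phi>1 x1 w \<longleftrightarrow> lifts_to_loop E2 \<phi>2 x2 ?m"
      using lifts_to_loop_iff_kernel[OF cov(1) xE(1) x1(2,3) w]
        lifts_to_loop_iff_kernel[OF cov(2) xE(2) x2(2,3) m] by simp
    also have "\<dots> \<longleftrightarrow> lifts_to_loop E2 \<phi>2 y2 (h \<circ> w)"
      using lifts_to_loop_conjugate[OF cov(2) d(1) d(3) hw(2,3)] unfolding d(2) y2_def .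
    finally show ?thesis .
  qed

  have "\<exists>H. homeomorphic_map E1 E2 H \<and> (\<forall>z\<in>topspace E1. \<phi>2 (H z) = h (\<phi>1 z))"
  proof (rule covering_homeomorphism[OF cov hk lpc conn xE(1) y2(1)])
    show "\<phi>2 y2 = h (\<phi>1 x1)" using y2(2) x1(2) by simp
    fix \<alpha> assume \<alpha>: "\<alpha> \<in> loops E1 x1"
    then have "\<phi>1 \<circ> \<alpha> \<in> loops T1 b1"
      using x1(2) covering_map_imp_continuous[OF cov(1)] by (auto simp: loops_def intro: pathin_compose)
    moreover have "lifts_to_loop E1 \<phi>1 x1 (\<phi>1 \<circ> \<alpha>)" using \<alpha> by (auto simp: lifts_to_loop_def)
    ultimately have "lifts_to_loop E2 \<phi>2 y2 (h \<circ> (\<phi>1 \<circ> \<alpha>))" using key by blast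
    then show "lifts_to_loop E2 \<phi>2 y2 (\<lambda>t. h (\<phi>1 (\<alpha> t)))" by (simp add: o_def)
  next
    fix \<beta> assume \<beta>: "\<beta> \<in> loops E2 y2"
    then have p: "pathin T2 (\<phi>2 \<circ> \<beta>)"
      using covering_map_imp_continuous[OF cov(2)] by (auto simp: loops_def intro: pathin_compose)
    then have "k \<circ> (\<phi>2 \<circ> \<beta>) \<in> loops T1 b1"
      using \<beta> y2(2) h(3)[OF b1T] pathin_compose[OF p h(2)] by (simp add: loops_def)
    moreover have "h ((k \<circ> (\<phi>2 \<circ> \<beta>)) t) = \<phi>2 (\<beta> t)" if "t \<in> {0..1}" for t
      using h(4)[of "\<phi>2 (\<beta> t)"] funcset_mem[OF path_image_subset_topspace[OF p] that] by simp
    then have "lifts_to_loop E2 \<phi>2 y2 (h \<circ> (k \<circ> (\<phi>2 \<circ> \<beta>)))"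
      using \<beta> by (auto simp: lifts_to_loop_def)
    ultimately have "lifts_to_loop E1 \<phi>1 x1 (k \<circ> (\<phi>2 \<circ> \<beta>))" using key by blast
    then show "lifts_to_loop E1 \<phi>1 x1 (\<lambda>t. k (\<phi>2 (\<beta> t)))" by (simp add: o_def)
  qed blast
  then obtain H where H: "homeomorphic_map E1 E2 H" "\<And>z. z \<in> topspace E1 \<Longrightarrow> \<phi>2 (H z) = h (\<phi>1 z)"
    by blast

  let ?D1 = "{x \<in> points X1. \<phi>1 x \<in> C1 - B1}" and ?D2 = "{x \<in> points X2. \<phi>2 x \<in> C2 - B2}"
  have C2: "C2 - B2 = h ` (C1 - B1)" using hdiff[OF C1] assms(23) by simp
  have hC: "h y \<in> C2 - B2 \<longleftrightarrow> y \<in> C1 - B1" if "y \<in> points Y" for y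
    unfolding C2 using inj_on_image_mem_iff[OF inj that, of "C1 - B1"] C1 by blast
  have C2Y: "C2 \<subseteq> points Y" using C1 surj assms(23) by blast
  have D: "topspace E1 \<inter> ?D1 = ?D1" "topspace E2 \<inter> ?D2 = ?D2"
    using C1 C2Y by (auto simp: tE1 tE2)
  have "homeomorphic_map (subtopology E1 ?D1) (subtopology E2 ?D2) H"
  proof (rule homeomorphic_map_subtopologies_alt[OF H(1)])
    fix z assume z: "z \<in> topspace E1" "H z \<in> topspace E2"
    then show "H z \<in> ?D2 \<longleftrightarrow> z \<in> ?D1"
      using H(2)[OF z(1)] hC[of "\<phi>1 z"] by (auto simp: tE1 tE2)
  qed
  moreover have "subtopology E1 ?D1 = subtopology (classical X1) ?D1"
    "subtopology E2 ?D2 = subtopology (classical X2) ?D2"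
    unfolding E1_def E2_def cover_complement_def subtopology_subtopology
    using D unfolding tE1 tE2 by simp_all
  ultimately have hom: "homeomorphic_map (subtopology (classical X1) ?D1) (subtopology (classical X2) ?D2) H"
    by simp
  have "inj_on ((`) H) (connected_components_of (subtopology (classical X1) ?D1))"
    by (rule inj_on_image)
      (use homeomorphic_imp_injective_map[OF hom] in \<open>simp only: Union_connected_components_of\<close>)
  then show ?thesis
    unfolding connected_number_def homeomorphic_map_connected_components_of[OF hom]
    by (simp add: card_image)
qed

end
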